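(* Let $p,q\ge 1$ be integers with $pq\ge 4$, let $m\ge 1$ and $n\ge 1$ be integers, and let $\alpha\in\mathbb C$. Let $\mathcal G(A)$ be the Kac–Moody algebra with Cartan matrix $A=\begin{pmatrix}2&-p\\-q&2\end{pmatrix}$, $N_-\subset\mathcal G(A)$ the subalgebra generated by $f_1,f_2$, and $\pi:\mathcal U(N_-)\to\mathcal U(\mathcal H)$ the projection onto the universal enveloping algebra of the Heisenberg algebra. With the words $V_k,\tilde V_k\in\mathcal U(N_-)$ (depending on $m,\alpha$), the numbers $\Gamma^k_1,\Gamma^k_2$ and the products $\mathcal H^{r,s}_w,\tilde{\mathcal H}^{r,s}_w$ defined in the context, the singular vectors of Verma modules over $\mathcal G(A)$ corresponding to real roots project as follows. 1. For the root $(a_{2n-1},\sigma a_{2n-2})$ (word $V_{2n-1}$): $$\pi(V_{2n-1})=\Big(\prod_{w=1}^{2n-2}\mathcal H_w^{2n-1,\,2n-3}\Big)\, f_1^{(\Gamma_1^{2n-1}-\Gamma_1^{2n-2})m}.$$ 2. For the root $(a_{2n-1},\sigma a_{2n})$ (word $V_{2n}$): $$\pi(V_{2n})=\Big(\prod_{w=1}^{2n-1}\mathcal H_w^{2n,\,2n-2}\Big)\, f_2^{(\Gamma_1^{2n}-\Gamma_1^{2n-1})m}.$$ 3. For the root $(\sigma^{-1}a_{2n-2},a_{2n-1})$ (word $\tilde V_{2n-1}$): $$\pi(\tilde V_{2n-1})=\Big(\prod_{w=1}^{2n-2}\tilde{\mathcal H}_w^{2n-2,\,2n-2}\Big)\,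 f_2^{(\Gamma_2^{2n}-\Gamma_2^{2n-1})m}.$$ 4. For the root $(\sigma^{-1}a_{2n},a_{2n-1})$ (word $\tilde V_{2n}$): $$\pi(\tilde V_{2n})=\Big(\prod_{w=1}^{2n-1}\tilde{\mathcal H}_w^{2n-1,\,2n-1}\Big)\, f_1^{(\Gamma_2^{2n+1}-\Gamma_2^{2n})m}.$$
   Context: **Algebra.** $\mathcal G(A)$ is the complex Lie algebra with generators $e_i,h_i,f_i$ ($i=1,2$) and relations $[h_i,h_j]=0$, $[h_i,e_j]=a_{ij}e_j$, $[h_i,f_j]=-a_{ij}f_j$, $[e_i,f_j]=\delta_{ij}h_i$, $(\mathrm{ad}\,e_i)^{1-a_{ij}}e_j=0=(\mathrm{ad}\,f_i)^{1-a_{ij}}f_j$ ($i\neq j$), where $A=(a_{ij})$, $a_{11}=a_{22}=2$, $a_{12}=-p$, $a_{21}=-q$. Thus $N_-$ is generated by $f_1,f_2$ with relations $(\mathrm{ad}f_1)^{p+1}f_2=0=(\mathrm{ad}f_2)^{q+1}f_1$. **Numbers.** $\sigma=\sqrt{q/p}$, $a_0=0$, $a_1=1$, $a_k=\sqrt{pq}\,a_{k-1}-a_{k-2}$; roots are written in coordinates with respect to the simple roots $\alpha_1,\alpha_2$. $\Gamma^0_1=\Gamma^0_2=0$ and $$\Gamma^{2l}_1=q\sum_{i=0}^{l-1}(-1)^i\binom{2l-i-1}{2l-2i-1}(pq)^{l-i-1},\quad \Gamma^{2l}_2=\sum_{i=0}^{l-1}(-1)^i\binom{2(l-1)-i}{2(l-1)-2i}(pq)^{l-i-1}\quad(l\ge1),$$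 $$\Gamma^{2l+1}_1=\sum_{i=0}^{l}(-1)^i\binom{2l-i}{2l-2i}(pq)^{l-i},\quad \Gamma^{2l+1}_2=p\sum_{i=0}^{l-1}(-1)^i\binom{2l-i-1}{2l-2i-1}(pq)^{l-i-1}\quad(l\ge0).$$ **Complex powers.** For $W\in\mathcal U(N_-)$, $f\in\{f_1,f_2\}$ and $a,b\in\mathbb C$ with $a+b\in\mathbb Z$, the expression $f^aWf^b$ denotes $\sum_{i\ge0}\binom{a}{i}(\mathrm{ad} f)^i(W)\,f^{a+b-i}$ (a finite sum) in the Ore localization of $\mathcal U(N_-)$ at the powers of $f$. **Singular vectors.** Put $V_1=f_1^m$, $\tilde V_1=f_2^m$ and, for $l\ge 1$, $$V_{2l}=f_2^{\Gamma_1^{2l-1}\alpha-\Gamma_1^{2l-2}m}\,V_{2l-1}\,f_2^{-\Gamma_1^{2l-1}\alpha+\Gamma_1^{2l}m},\qquad V_{2l+1}=f_1^{\Gamma_2^{2l+1}\alpha-\Gamma_2^{2l}m}\,V_{2l}\,f_1^{-\Gamma_2^{2l+1}\alpha+\Gamma_2^{2l+2}m},$$ $$\tilde V_{2l}=f_1^{\Gamma_2^{2l}\alpha-\Gamma_2^{2l-1}m}\,\tilde V_{2l-1}\,f_1^{-\Gamma_2^{2l}\alpha+\Gamma_2^{2l+1}m},\qquad \tilde V_{2l+1}=f_2^{\Gamma_1^{2l}\alpha-\Gamma_1^{2l-1}m}\,\tilde V_{2l}\,f_2^{-\Gamma_1^{2l}\alpha+\Gamma_1^{2l+1}m}.$$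 All exponent pairs have integer sums, and (Feigin–Fuchs–Malikov) all these expressions lie in $\mathcal U(N_-)$. Applied to the vacuum vector of suitable Verma modules they give the singular vectors of degree $m\gamma$, $\gamma$ being the listed real root. **Heisenberg algebra.** $\mathcal H$ is the 3-dimensional Lie algebra with basis $f_1,f_2,h$, $[f_1,f_2]=h$, $h$ central. $\pi:\mathcal U(N_-)\to\mathcal U(\mathcal H)$ is the algebra homomorphism with $f_i\mapsto f_i$ (the quotient by the two-sided ideal generated by $[f_1,[f_1,f_2]]$, $[f_2,[f_1,f_2]]$). For $u\in\mathbb C$, $H_u=f_2f_1+uh$; the $H_u$ commute with each other. **Products.** Sums over empty ranges are $0$. For integers $r,s\ge 0$ (or $s=-1$, when all sums up to $s$ are empty), $\mathcal H^{r,s}_0=\tilde{\mathcal H}^{r,s}_0=1$, $$\mathcal H_1^{r,s}=\prod_{k=1}^{(\Gamma_2^2-\Gamma_1^0)m}H_{\big(\sum_{i=2}^r(-1)^{i-1}\Gamma_2^i\big)\alpha+\big(\sum_{i=1}^s(-1)^i\Gamma_1^i\big)m+k},$$ $$\tilde{\mathcal H}_1^{r,s}=\prod_{k=1}^{(\Gamma_2^2-\Gamma_2^1)m}H_{\big(\sum_{i=1}^r(-1)^{i-1}\Gamma_1^i\big)\alpha+\big(\sum_{i=2}^s(-1)^i\Gamma_2^i\big)m-(k-1)},$$ and for $j\ge1$ $$\mathcal H_{2j}^{r,s}=\prod_{k=1}^{(\Gamma_1^{2j}-\Gamma_2^{2j})m}H_{\big(\sum_{i=2j+1}^r(-1)^{i-1}\Gamma_2^i\big)\alpha+\big(\sum_{i=2j-1}^s(-1)^i\Gamma_1^i\big)m-(k-1)},$$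 $$\mathcal H_{2j+1}^{r,s}=\prod_{k=1}^{(\Gamma_2^{2j+2}-\Gamma_1^{2j})m}H_{\big(\sum_{i=2j+2}^r(-1)^{i-1}\Gamma_2^i\big)\alpha+\big(\sum_{i=2j}^s(-1)^i\Gamma_1^i\big)m+k},$$ $$\tilde{\mathcal H}_{2j}^{r,s}=\prod_{k=1}^{(\Gamma_2^{2j+1}-\Gamma_2^{2j})m}H_{\big(\sum_{i=2j}^r(-1)^{i-1}\Gamma_1^i\big)\alpha+\big(\sum_{i=2j}^s(-1)^i\Gamma_2^i\big)m+k},$$ $$\tilde{\mathcal H}_{2j+1}^{r,s}=\prod_{k=1}^{(\Gamma_2^{2j+2}-\Gamma_2^{2j+1})m}H_{\big(\sum_{i=2j+1}^r(-1)^{i-1}\Gamma_1^i\big)\alpha+\big(\sum_{i=2j+1}^s(-1)^i\Gamma_2^i\big)m-(k-1)}.$$ If $p,q\ge2$ all upper limits and all exponents of the final factor are nonnegative. If $p=1$ or $q=1$ some may be negative; then the right-hand sides are read in the skew field of fractions of the Ore domain $\mathcal U(\mathcal H)$, with the convention $\prod_{k=1}^{-N}c_k=\prod_{k=-N+1}^{0}c_k^{-1}$ for $N>0$. *)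

theory Defs
  imports Complex_Main "HOL-Algebra.QuotRing" "HOL-Library.Poly_Mapping"
begin

section \<open>Complex Lie algebras and presentations\<close>

record 'a lie = "'a partial_object" +
  lie_add :: "'a \<Rightarrow> 'a \<Rightarrow> 'a"
  lie_scale :: "complex \<Rightarrow> 'a \<Rightarrow> 'a"
  lie_bracket :: "'a \<Rightarrow> 'a \<Rightarrow> 'a"

datatype 'g lie_term =
    LGen 'g
  | LZero
  | LAdd "'g lie_term" "'g lie_term"
  | LScale complex "'g lie_term"
  | LBr "'g lie_term" "'g lie_term"

text \<open>
  The least congruence on Lie terms that contains the pairs in \<open>R\<close> and validates the axioms of a
  complex Lie algebra.
\<close>

inductive lie_eq :: "('g lie_term \<times> 'g lie_term) set \<Rightarrow> 'g lie_term \<Rightarrow> 'g lie_term \<Rightarrow> bool"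
  for R :: "('g lie_term \<times> 'g lie_term) set" where
  rel: "(s, t) \<in> R \<Longrightarrow> lie_eq R s t"
| refl: "lie_eq R s s"
| sym: "lie_eq R s t \<Longrightarrow> lie_eq R t s"
| trans: "lie_eq R s t \<Longrightarrow> lie_eq R t u \<Longrightarrow> lie_eq R s u"
| add_cong: "lie_eq R s s' \<Longrightarrow> lie_eq R t t' \<Longrightarrow> lie_eq R (LAdd s t) (LAdd s' t')"
| scale_cong: "lie_eq R s s' \<Longrightarrow> lie_eq R (LScale c s) (LScale c s')"
| br_cong: "lie_eq R s s' \<Longrightarrow> lie_eq R t t' \<Longrightarrow> lie_eq R (LBr s t) (LBr s' t')"
| add_assoc: "lie_eq R (LAdd (LAdd s t) u) (LAdd s (LAdd t u))"
| add_commute: "lie_eq R (LAdd s t) (LAdd t s)"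
| add_zero: "lie_eq R (LAdd s LZero) s"
| add_minus: "lie_eq R (LAdd s (LScale (-1) s)) LZero"
| scale_add: "lie_eq R (LScale c (LAdd s t)) (LAdd (LScale c s) (LScale c t))"
| add_scale: "lie_eq R (LScale (c + d) s) (LAdd (LScale c s) (LScale d s))"
| scale_scale: "lie_eq R (LScale c (LScale d s)) (LScale (c * d) s)"
| scale_one: "lie_eq R (LScale 1 s) s"
| br_add_left: "lie_eq R (LBr (LAdd s t) u) (LAdd (LBr s u) (LBr t u))"
| br_add_right: "lie_eq R (LBr s (LAdd t u)) (LAdd (LBr s t) (LBr s u))"
| br_scale_left: "lie_eq R (LBr (LScale c s) t) (LScale c (LBr s t))"
| br_scale_right: "lie_eq R (LBr s (LScale c t)) (LScale c (LBr s t))"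
| br_self: "lie_eq R (LBr s s) LZero"
| jacobi: "lie_eq R (LAdd (LBr s (LBr t u)) (LAdd (LBr t (LBr u s)) (LBr u (LBr s t)))) LZero"

definition lie_class ::
  "('g lie_term \<times> 'g lie_term) set \<Rightarrow> 'g lie_term \<Rightarrow> 'g lie_term set" where
  "lie_class R s = {t. lie_eq R s t}"

definition presented_lie :: "('g lie_term \<times> 'g lie_term) set \<Rightarrow> 'g lie_term set lie" where
  "presented_lie R =
    \<lparr> carrier = range (lie_class R),
      lie_add = (\<lambda>X Y. {t. \<exists>x\<in>X. \<exists>y\<in>Y. lie_eq R (LAdd x y) t}),
      lie_scale = (\<lambda>c X. {t. \<exists>x\<in>X. lie_eq R (LScale c x) t}),
      lie_bracket = (\<lambda>X Y. {t. \<exists>x\<in>X. \<exists>y\<in>Y. lie_eq R (LBr x y) t}) \<rparr>"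

inductive_set lie_span :: "'a lie \<Rightarrow> 'a set \<Rightarrow> 'a set" for L :: "'a lie" and S :: "'a set" where
  base: "x \<in> S \<Longrightarrow> x \<in> lie_span L S"
| add: "x \<in> lie_span L S \<Longrightarrow> y \<in> lie_span L S \<Longrightarrow> lie_add L x y \<in> lie_span L S"
| scale: "x \<in> lie_span L S \<Longrightarrow> lie_scale L c x \<in> lie_span L S"
| bracket: "x \<in> lie_span L S \<Longrightarrow> y \<in> lie_span L S \<Longrightarrow> lie_bracket L x y \<in> lie_span L S"

definition generated_lie :: "'a lie \<Rightarrow> 'a set \<Rightarrow> 'a lie" where
  "generated_lie L S = L\<lparr>carrier := lie_span L S\<rparr>"


section \<open>The Kac--Moody algebra, its negative part, and the Heisenberg algebra\<close>

datatype 'i chevalley = E 'i | H 'i | F 'i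

definition kac_moody_rels ::
  "('i \<Rightarrow> 'i \<Rightarrow> int) \<Rightarrow> ('i chevalley lie_term \<times> 'i chevalley lie_term) set" where
  "kac_moody_rels A =
      {(LBr (LGen (H i)) (LGen (H j)), LZero) | i j. True}
    \<union> {(LBr (LGen (H i)) (LGen (E j)), LScale (of_int (A i j)) (LGen (E j))) | i j. True}
    \<union> {(LBr (LGen (H i)) (LGen (F j)), LScale (- of_int (A i j)) (LGen (F j))) | i j. True}
    \<union> {(LBr (LGen (E i)) (LGen (F j)), if i = j then LGen (H i) else LZero) | i j. True}
    \<union> {((LBr (LGen (E i)) ^^ nat (1 - A i j)) (LGen (E j)), LZero) | i j. i \<noteq> j}
    \<union> {((LBr (LGen (F i)) ^^ nat (1 - A i j)) (LGen (F j)), LZero) | i j. i \<noteq> j}"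

definition kac_moody :: "('i \<Rightarrow> 'i \<Rightarrow> int) \<Rightarrow> 'i chevalley lie_term set lie" where
  "kac_moody A = presented_lie (kac_moody_rels A)"

definition km_f :: "('i \<Rightarrow> 'i \<Rightarrow> int) \<Rightarrow> 'i \<Rightarrow> 'i chevalley lie_term set" where
  "km_f A i = lie_class (kac_moody_rels A) (LGen (F i))"

definition n_minus :: "('i \<Rightarrow> 'i \<Rightarrow> int) \<Rightarrow> 'i chevalley lie_term set lie" where
  "n_minus A = generated_lie (kac_moody A) (range (km_f A))"

datatype node = N1 | N2

fun cartan :: "nat \<Rightarrow> nat \<Rightarrow> node \<Rightarrow> node \<Rightarrow> int" where
  "cartan p q N1 N1 = 2"
| "cartan p q N1 N2 = - int p"
| "cartan p q N2 N1 = - int q"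
| "cartan p q N2 N2 = 2"

text \<open>The triple \<open>(a, b, c)\<close> stands for \<open>a f\<^sub>1 + b f\<^sub>2 + c h\<close>.\<close>

definition heisenberg :: "(complex \<times> complex \<times> complex) lie" where
  "heisenberg =
    \<lparr> carrier = UNIV,
      lie_add = (\<lambda>(a, b, c) (a', b', c'). (a + a', b + b', c + c')),
      lie_scale = (\<lambda>z (a, b, c). (z * a, z * b, z * c)),
      lie_bracket = (\<lambda>(a, b, c) (a', b', c'). (0, 0, a * b' - b * a')) \<rparr>"

fun heis_f :: "node \<Rightarrow> complex \<times> complex \<times> complex" where
  "heis_f N1 = (1, 0, 0)"
| "heis_f N2 = (0, 1, 0)"

definition heis_h :: "complex \<times> complex \<times> complex" where
  "heis_h = (0, 0, 1)"


section \<open>Universal enveloping algebras\<close>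

datatype 'a word = Word (letters: "'a list")

instantiation word :: (type) monoid_add
begin

definition zero_word :: "'a word" where
  "0 = Word []"

definition plus_word :: "'a word \<Rightarrow> 'a word \<Rightarrow> 'a word" where
  "v + w = Word (letters v @ letters w)"

instance
  by standard (simp_all add: zero_word_def plus_word_def)

end

text \<open>
  With concatenation as the addition of words, the convolution product of finitely supported
  functions is the product of the free associative algebra.
\<close>

definition free_algebra :: "'a set \<Rightarrow> ('a word \<Rightarrow>\<^sub>0 complex) ring" where
  "free_algebra X =
    \<lparr> carrier = {u. \<forall>w \<in> Poly_Mapping.keys u. set (letters w) \<subseteq> X},
      mult = (*), one = 1, zero = 0, add = (+) \<rparr>"

definition letter :: "'a \<Rightarrow> 'a word \<Rightarrow>\<^sub>0 complex" where
  "letter x = Poly_Mapping.single (Word [x]) 1"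

lemma ring_free_algebra: "ring (free_algebra X)"
proof -
  let ?C = "{u :: 'a word \<Rightarrow>\<^sub>0 complex. \<forall>w \<in> Poly_Mapping.keys u. set (letters w) \<subseteq> X}"
  have add: "u + v \<in> ?C" if "u \<in> ?C" "v \<in> ?C" for u v
    using that Poly_Mapping.keys_add[of u v] by blast
  have mult: "u * v \<in> ?C" if "u \<in> ?C" "v \<in> ?C" for u v
  proof -
    have "set (letters w) \<subseteq> X" if w: "w \<in> Poly_Mapping.keys (u * v)" for w
    proof -
      obtain a b where "a \<in> Poly_Mapping.keys u" "b \<in> Poly_Mapping.keys v" "w = a + b"
        using keys_mult[of u v] w by blast
      then show ?thesis
        using \<open>u \<in> ?C\<close> \<open>v \<in> ?C\<close> by (auto simp: plus_word_def)
    qed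
    then show ?thesis by blast
  qed
  have uminus: "- u \<in> ?C" if "u \<in> ?C" for u
    using that by simp
  have one: "1 \<in> ?C"
    by (simp add: zero_word_def)
  have car: "carrier (free_algebra X) = ?C"
    and ops: "mult (free_algebra X) = (*)" "one (free_algebra X) = 1"
      "zero (free_algebra X) = 0" "add (free_algebra X) = (+)"
    by (simp_all only: free_algebra_def partial_object.simps monoid.simps ring.simps)
  have zero: "0 \<in> ?C"
    by simp
  show ?thesis
  proof (rule ringI)
    show "abelian_group (free_algebra X)"
    proof (rule abelian_groupI, unfold car ops)
      fix u v w :: "'a word \<Rightarrow>\<^sub>0 complex"
      assume u: "u \<in> ?C" and v: "v \<in> ?C" and w: "w \<in> ?C"
      show "u + v \<in> ?C" by (rule add[OF u v])
      show "u + v + w = u + (v + w)" by (rule add.assoc)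
      show "u + v = v + u" by (rule add.commute)
      show "0 + u = u" by (rule add_0_left)
      show "\<exists>v\<in>?C. v + u = 0" by (rule bexI[where x = "- u"], rule left_minus, rule uminus[OF u])
    qed (rule zero)
    show "Group.monoid (free_algebra X)"
    proof (rule monoidI, unfold car ops)
      fix u v w :: "'a word \<Rightarrow>\<^sub>0 complex"
      assume u: "u \<in> ?C" and v: "v \<in> ?C" and w: "w \<in> ?C"
      show "u * v \<in> ?C" by (rule mult[OF u v])
      show "u * v * w = u * (v * w)" by (rule mult.assoc)
      show "1 * u = u" by (rule mult_1_left)
      show "u * 1 = u" by (rule mult_1_right)
    qed (rule one)
  qed (unfold ops, rule distrib_right, rule distrib_left)
qed

definition env_ideal :: "'a lie \<Rightarrow> ('a word \<Rightarrow>\<^sub>0 complex) set" where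
  "env_ideal L = Idl\<^bsub>free_algebra (carrier L)\<^esub>
     ( {letter (lie_add L x y) - (letter x + letter y) | x y. x \<in> carrier L \<and> y \<in> carrier L}
     \<union> {letter (lie_scale L c x) - Poly_Mapping.single 0 c * letter x | c x. x \<in> carrier L}
     \<union> {letter x * letter y - letter y * letter x - letter (lie_bracket L x y)
         | x y. x \<in> carrier L \<and> y \<in> carrier L})"

definition env :: "'a lie \<Rightarrow> ('a word \<Rightarrow>\<^sub>0 complex) set ring" where
  "env L = free_algebra (carrier L) Quot env_ideal L"

definition env_gen :: "'a lie \<Rightarrow> 'a \<Rightarrow> ('a word \<Rightarrow>\<^sub>0 complex) set" where
  "env_gen L x = env_ideal L +>\<^bsub>free_algebra (carrier L)\<^esub> letter x"

definition env_const :: "'a lie \<Rightarrow> complex \<Rightarrow> ('a word \<Rightarrow>\<^sub>0 complex) set" where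
  "env_const L c = env_ideal L +>\<^bsub>free_algebra (carrier L)\<^esub> Poly_Mapping.single 0 c"

definition env_algebra_hom ::
  "'a lie \<Rightarrow> 'b lie \<Rightarrow> (('a word \<Rightarrow>\<^sub>0 complex) set \<Rightarrow> ('b word \<Rightarrow>\<^sub>0 complex) set) \<Rightarrow> bool" where
  "env_algebra_hom L M \<phi> \<longleftrightarrow>
     \<phi> \<in> ring_hom (env L) (env M) \<and> (\<forall>c. \<phi> (env_const L c) = env_const M c)"

type_synonym n_minus_env = "(node chevalley lie_term set word \<Rightarrow>\<^sub>0 complex) set"
type_synonym heis_env = "((complex \<times> complex \<times> complex) word \<Rightarrow>\<^sub>0 complex) set"

abbreviation U_N :: "nat \<Rightarrow> nat \<Rightarrow> n_minus_env ring" where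
  "U_N p q \<equiv> env (n_minus (cartan p q))"

abbreviation U_H :: "heis_env ring" where
  "U_H \<equiv> env heisenberg"

definition U_N_f :: "nat \<Rightarrow> nat \<Rightarrow> node \<Rightarrow> n_minus_env" where
  "U_N_f p q i = env_gen (n_minus (cartan p q)) (km_f (cartan p q) i)"

definition U_H_f :: "node \<Rightarrow> heis_env" where
  "U_H_f i = env_gen heisenberg (heis_f i)"

definition U_H_h :: heis_env where
  "U_H_h = env_gen heisenberg heis_h"

text \<open>
  An algebra homomorphism out of \<open>U(N\<^sub>-)\<close> is determined by the images of \<open>f\<^sub>1\<close> and \<open>f\<^sub>2\<close>, so at
  most one function (on the carrier) satisfies this predicate.
\<close>

definition is_projection :: "nat \<Rightarrow> nat \<Rightarrow> (n_minus_env \<Rightarrow> heis_env) \<Rightarrow> bool" where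
  "is_projection p q \<pi> \<longleftrightarrow>
     env_algebra_hom (n_minus (cartan p q)) heisenberg \<pi> \<and> (\<forall>i. \<pi> (U_N_f p q i) = U_H_f i)"


section \<open>Ore localization and complex powers\<close>

text \<open>
  The localization of \<open>R\<close> at \<open>S\<close> is characterised in the usual way up to unique isomorphism over
  \<open>R\<close>. Right fractions are used; for a two-sided Ore set the left fractions give the same ring.
\<close>

definition ore_localization ::
  "('a, 'c) ring_scheme \<Rightarrow> 'a set \<Rightarrow> ('b, 'd) ring_scheme \<Rightarrow> ('a \<Rightarrow> 'b) \<Rightarrow> bool" where
  "ore_localization R S Q \<iota> \<longleftrightarrow>
     ring Q \<and> \<iota> \<in> ring_hom R Q \<and>
     (\<forall>s\<in>S. \<iota> s \<in> Units Q) \<and>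
     (\<forall>x\<in>carrier Q. \<exists>r\<in>carrier R. \<exists>s\<in>S. x = \<iota> r \<otimes>\<^bsub>Q\<^esub> inv\<^bsub>Q\<^esub> (\<iota> s)) \<and>
     (\<forall>r\<in>carrier R. \<iota> r = \<zero>\<^bsub>Q\<^esub> \<longleftrightarrow> (\<exists>s\<in>S. r \<otimes>\<^bsub>R\<^esub> s = \<zero>\<^bsub>R\<^esub>))"

definition skew_field_of_fractions ::
  "('a, 'c) ring_scheme \<Rightarrow> ('b, 'd) ring_scheme \<Rightarrow> ('a \<Rightarrow> 'b) \<Rightarrow> bool" where
  "skew_field_of_fractions R K \<kappa> \<longleftrightarrow> ore_localization R (carrier R - {\<zero>\<^bsub>R\<^esub>}) K \<kappa>"

definition powers :: "('a, 'c) ring_scheme \<Rightarrow> 'a \<Rightarrow> 'a set" where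
  "powers R x = {x [^]\<^bsub>R\<^esub> n | n :: nat. True}"

definition ad :: "('a, 'c) ring_scheme \<Rightarrow> 'a \<Rightarrow> 'a \<Rightarrow> 'a" where
  "ad R x y = x \<otimes>\<^bsub>R\<^esub> y \<ominus>\<^bsub>R\<^esub> y \<otimes>\<^bsub>R\<^esub> x"

text \<open>
  \<open>W'\<close> is the element \<open>f\<^sup>a W f\<^sup>b\<close>: the exponents have integer sum, \<open>W'\<close> lies in the enveloping algebra,
  and its image in the localization \<open>Q\<close> at the powers of \<open>f\<close> is the defining sum. The
  index set of the sum is finite for \<open>L = N\<^sub>-\<close> and \<open>f = f\<^sub>i\<close> since \<open>ad f\<^sub>i\<close> is locally nilpotent.
\<close>

definition is_power_conj ::
  "'a lie \<Rightarrow> 'b ring \<Rightarrow> (('a word \<Rightarrow>\<^sub>0 complex) set \<Rightarrow> 'b) \<Rightarrow>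
   ('a word \<Rightarrow>\<^sub>0 complex) set \<Rightarrow> complex \<Rightarrow> ('a word \<Rightarrow>\<^sub>0 complex) set \<Rightarrow> complex \<Rightarrow>
   ('a word \<Rightarrow>\<^sub>0 complex) set \<Rightarrow> bool" where
  "is_power_conj L Q \<iota> f a W b W' \<longleftrightarrow>
     W' \<in> carrier (env L) \<and>
     (\<exists>s::int. a + b = of_int s \<and>
        \<iota> W' = (\<Oplus>\<^bsub>Q\<^esub> i \<in> {i. (ad (env L) f ^^ i) W \<noteq> \<zero>\<^bsub>env L\<^esub>}.
                  \<iota> (env_const L (a gchoose i) \<otimes>\<^bsub>env L\<^esub> (ad (env L) f ^^ i) W)
                  \<otimes>\<^bsub>Q\<^esub> \<iota> f [^]\<^bsub>Q\<^esub> (s - int i)))"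


section \<open>The numbers \<open>\<Gamma>\<close> and the singular words\<close>

definition Gamma1 :: "nat \<Rightarrow> nat \<Rightarrow> nat \<Rightarrow> int" where
  "Gamma1 p q k = (let l = k div 2 in
     if even k then
       int q * (\<Sum>i<l. (-1) ^ i * int ((2*l - i - 1) choose (2*l - 2*i - 1)) * int (p*q) ^ (l - i - 1))
     else
       (\<Sum>i\<le>l. (-1) ^ i * int ((2*l - i) choose (2*l - 2*i)) * int (p*q) ^ (l - i)))"

definition Gamma2 :: "nat \<Rightarrow> nat \<Rightarrow> nat \<Rightarrow> int" where
  "Gamma2 p q k = (let l = k div 2 in
     if even k then
       (\<Sum>i<l. (-1) ^ i * int ((2*(l-1) - i) choose (2*(l-1) - 2*i)) * int (p*q) ^ (l - i - 1))
     else
       int p * (\<Sum>i<l. (-1) ^ i * int ((2*l - i - 1) choose (2*l - 2*i - 1)) * int (p*q) ^ (l - i - 1)))"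

abbreviation is_f_power_conj ::
  "nat \<Rightarrow> nat \<Rightarrow> (node \<Rightarrow> 'b ring) \<Rightarrow> (node \<Rightarrow> n_minus_env \<Rightarrow> 'b) \<Rightarrow> node \<Rightarrow>
   complex \<Rightarrow> n_minus_env \<Rightarrow> complex \<Rightarrow> n_minus_env \<Rightarrow> bool" where
  "is_f_power_conj p q Q \<iota> i \<equiv> is_power_conj (n_minus (cartan p q)) (Q i) (\<iota> i) (U_N_f p q i)"

definition is_V ::
  "nat \<Rightarrow> nat \<Rightarrow> (node \<Rightarrow> 'b ring) \<Rightarrow> (node \<Rightarrow> n_minus_env \<Rightarrow> 'b) \<Rightarrow> nat \<Rightarrow> complex \<Rightarrow>
   (nat \<Rightarrow> n_minus_env) \<Rightarrow> bool" where
  "is_V p q Q \<iota> m \<alpha> V \<longleftrightarrow>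
     (let \<Gamma>1 = (\<lambda>k. of_int (Gamma1 p q k)); \<Gamma>2 = (\<lambda>k. of_int (Gamma2 p q k)); m' = of_nat m in
      V 1 = U_N_f p q N1 [^]\<^bsub>U_N p q\<^esub> m \<and>
      (\<forall>l\<ge>1.
         is_f_power_conj p q Q \<iota> N2
           (\<Gamma>1 (2*l - 1) * \<alpha> - \<Gamma>1 (2*l - 2) * m') (V (2*l - 1))
           (- \<Gamma>1 (2*l - 1) * \<alpha> + \<Gamma>1 (2*l) * m') (V (2*l)) \<and>
         is_f_power_conj p q Q \<iota> N1
           (\<Gamma>2 (2*l + 1) * \<alpha> - \<Gamma>2 (2*l) * m') (V (2*l))
           (- \<Gamma>2 (2*l + 1) * \<alpha> + \<Gamma>2 (2*l + 2) * m') (V (2*l + 1))))"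

definition is_V_tilde ::
  "nat \<Rightarrow> nat \<Rightarrow> (node \<Rightarrow> 'b ring) \<Rightarrow> (node \<Rightarrow> n_minus_env \<Rightarrow> 'b) \<Rightarrow> nat \<Rightarrow> complex \<Rightarrow>
   (nat \<Rightarrow> n_minus_env) \<Rightarrow> bool" where
  "is_V_tilde p q Q \<iota> m \<alpha> V \<longleftrightarrow>
     (let \<Gamma>1 = (\<lambda>k. of_int (Gamma1 p q k)); \<Gamma>2 = (\<lambda>k. of_int (Gamma2 p q k)); m' = of_nat m in
      V 1 = U_N_f p q N2 [^]\<^bsub>U_N p q\<^esub> m \<and>
      (\<forall>l\<ge>1.
         is_f_power_conj p q Q \<iota> N1
           (\<Gamma>2 (2*l) * \<alpha> - \<Gamma>2 (2*l - 1) * m') (V (2*l - 1))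
           (- \<Gamma>2 (2*l) * \<alpha> + \<Gamma>2 (2*l + 1) * m') (V (2*l)) \<and>
         is_f_power_conj p q Q \<iota> N2
           (\<Gamma>1 (2*l) * \<alpha> - \<Gamma>1 (2*l - 1) * m') (V (2*l))
           (- \<Gamma>1 (2*l) * \<alpha> + \<Gamma>1 (2*l + 1) * m') (V (2*l + 1))))"


section \<open>The products\<close>

definition H_elem :: "complex \<Rightarrow> heis_env" where
  "H_elem u = U_H_f N2 \<otimes>\<^bsub>U_H\<^esub> U_H_f N1 \<oplus>\<^bsub>U_H\<^esub> env_const heisenberg u \<otimes>\<^bsub>U_H\<^esub> U_H_h"

definition list_prod :: "('a, 'c) monoid_scheme \<Rightarrow> 'a list \<Rightarrow> 'a" where
  "list_prod G xs = foldr (mult G) xs \<one>\<^bsub>G\<^esub>"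

definition upto_prod :: "('a, 'c) monoid_scheme \<Rightarrow> int \<Rightarrow> (int \<Rightarrow> 'a) \<Rightarrow> 'a" where
  "upto_prod G N c =
     (if N \<ge> 0 then list_prod G (map c [1..N])
      else list_prod G (map (\<lambda>k. inv\<^bsub>G\<^esub> (c k)) [N + 1..0]))"

text \<open>Upper limits of the sums are integers because \<open>s = -1\<close> occurs.\<close>

definition alt_sum :: "(nat \<Rightarrow> int) \<Rightarrow> nat \<Rightarrow> int \<Rightarrow> int" where
  "alt_sum g lo hi = (\<Sum>i \<in> {i. lo \<le> i \<and> int i \<le> hi}. (-1) ^ i * g i)"

text \<open>
  The signs \<open>(-1)^(i-1)\<close> in the coefficient of \<open>\<alpha>\<close> appear as a minus sign in front of \<open>alt_sum\<close>.
  The products are formed in a ring \<open>K\<close> receiving \<open>U(\<H>)\<close> via \<open>\<kappa>\<close>.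
\<close>

definition H_prod ::
  "nat \<Rightarrow> nat \<Rightarrow> nat \<Rightarrow> complex \<Rightarrow> 'k ring \<Rightarrow> (heis_env \<Rightarrow> 'k) \<Rightarrow> int \<Rightarrow> int \<Rightarrow> nat \<Rightarrow> 'k" where
  "H_prod p q m \<alpha> K \<kappa> r s w =
     (let \<Gamma>1 = Gamma1 p q; \<Gamma>2 = Gamma2 p q; m' = int m; j = w div 2;
          u = (\<lambda>a c. \<kappa> (H_elem (of_int a * \<alpha> + of_int c))) in
      if w = 0 then \<one>\<^bsub>K\<^esub>
      else if w = 1 then
        upto_prod K ((\<Gamma>2 2 - \<Gamma>1 0) * m')
          (\<lambda>k. u (- alt_sum \<Gamma>2 2 r) (alt_sum \<Gamma>1 1 s * m' + k))
      else if even w then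
        upto_prod K ((\<Gamma>1 (2*j) - \<Gamma>2 (2*j)) * m')
          (\<lambda>k. u (- alt_sum \<Gamma>2 (2*j + 1) r) (alt_sum \<Gamma>1 (2*j - 1) s * m' - (k - 1)))
      else
        upto_prod K ((\<Gamma>2 (2*j + 2) - \<Gamma>1 (2*j)) * m')
          (\<lambda>k. u (- alt_sum \<Gamma>2 (2*j + 2) r) (alt_sum \<Gamma>1 (2*j) s * m' + k)))"

definition H_prod_tilde ::
  "nat \<Rightarrow> nat \<Rightarrow> nat \<Rightarrow> complex \<Rightarrow> 'k ring \<Rightarrow> (heis_env \<Rightarrow> 'k) \<Rightarrow> int \<Rightarrow> int \<Rightarrow> nat \<Rightarrow> 'k" where
  "H_prod_tilde p q m \<alpha> K \<kappa> r s w =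
     (let \<Gamma>1 = Gamma1 p q; \<Gamma>2 = Gamma2 p q; m' = int m; j = w div 2;
          u = (\<lambda>a c. \<kappa> (H_elem (of_int a * \<alpha> + of_int c))) in
      if w = 0 then \<one>\<^bsub>K\<^esub>
      else if w = 1 then
        upto_prod K ((\<Gamma>2 2 - \<Gamma>2 1) * m')
          (\<lambda>k. u (- alt_sum \<Gamma>1 1 r) (alt_sum \<Gamma>2 2 s * m' - (k - 1)))
      else if even w then
        upto_prod K ((\<Gamma>2 (2*j + 1) - \<Gamma>2 (2*j)) * m')
          (\<lambda>k. u (- alt_sum \<Gamma>1 (2*j) r) (alt_sum \<Gamma>2 (2*j) s * m' + k))
      else
        upto_prod K ((\<Gamma>2 (2*j + 2) - \<Gamma>2 (2*j + 1)) * m')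
          (\<lambda>k. u (- alt_sum \<Gamma>1 (2*j + 1) r) (alt_sum \<Gamma>2 (2*j + 1) s * m' - (k - 1))))"

end

theory Submission
  imports Defs
begin

text \<open>
  Since \<open>f\<^sub>1 H\<^sub>u = H\<^bsub>u+1\<^esub> f\<^sub>1\<close> and \<open>f\<^sub>2 H\<^sub>u = H\<^bsub>u-1\<^esub> f\<^sub>2\<close>, conjugation by a complex power of \<open>f\<^sub>i\<close>
  translates the indices of a quotient of products of the \<open>H\<^sub>u\<close>, and \<open>f\<^sub>1\<^sup>N f\<^sub>2\<^sup>N = \<Prod>\<^sub>k H\<^sub>k\<close> lets one write a power
  of one generator as such a quotient times a power of the other. If \<open>\<pi>(V\<^sub>k)\<close> is a product of
  factors \<open>H\<^sub>u\<close> times \<open>f\<^sub>i\<^sup>N\<close>, the next word therefore translates the factors already present and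
  contributes one new block. With \<open>a\<^sub>i\<close> the left exponent of the \<open>i\<close>-th step, the block created at step
  \<open>w\<close> is shifted in \<open>V\<^sub>k\<close> by \<open>\<Sum>\<^bsub>w\<le>i<k\<^esub> (-1)\<^sup>i a\<^sub>i\<close>, and in the tilde words by its negative. The only
  relation between the \<open>\<Gamma>\<close> that is needed is \<open>\<Gamma>\<^sub>1\<^bsup>2l+1\<^esup> = \<Gamma>\<^sub>2\<^bsup>2l+2\<^esup>\<close>.
\<close>

section \<open>Polynomial functions with values in a complex algebra\<close>

lemma (in abelian_monoid) finsum_lessThan_Suc:
  assumes "\<And>i. f i \<in> carrier G"
  shows "finsum G f {..<Suc n} = finsum G f {..<n} \<oplus> f n"
  using assms by (simp add: lessThan_Suc a_comm)

lemma (in abelian_monoid) finsum_lessThan_Suc_shift: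
  assumes f: "\<And>i. f i \<in> carrier G"
  shows "finsum G f {..<Suc n} = f 0 \<oplus> finsum G (\<lambda>i. f (Suc i)) {..<n}"
  by (induction n) (simp_all add: finsum_lessThan_Suc f a_assoc finsum_closed Pi_def)

lemma (in monoid) Units_r_cancel:
  assumes "a \<in> Units G" "b \<in> carrier G" "c \<in> carrier G" "b \<otimes> a = c \<otimes> a"
  shows "b = c"
  using assms by (metis Units_closed Units_inv_closed Units_r_inv m_assoc r_one)

lemma (in monoid) inv_mult_Units:
  assumes "a \<in> Units G" "b \<in> Units G"
  shows "inv (a \<otimes> b) = inv b \<otimes> inv a"
  using group.inv_mult_group[OF units_group, of a b] assms
  by (simp add: units_of_carrier units_of_mult units_of_inv)

lemma (in monoid) commute_inv:
  assumes x: "x \<in> Units G" and y: "y \<in> carrier G" and c: "x \<otimes> y = y \<otimes> x"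
  shows "inv x \<otimes> y = y \<otimes> inv x"
proof -
  have "inv x \<otimes> y = inv x \<otimes> (y \<otimes> x) \<otimes> inv x"
    using x y by (simp add: m_assoc Units_closed)
  also have "\<dots> = inv x \<otimes> (x \<otimes> y) \<otimes> inv x"
    by (simp add: c)
  also have "\<dots> = y \<otimes> inv x"
    using x y by (simp add: m_assoc[symmetric] Units_closed)
  finally show ?thesis .
qed

lemma (in monoid) nat_pow_Units: "x \<in> Units G \<Longrightarrow> x [^] (n::nat) \<in> Units G"
  by (induction n) auto

lemma (in monoid) int_pow_units_of:
  assumes "x \<in> Units G"
  shows "x [^]\<^bsub>units_of G\<^esub> (z::int) = x [^] z"
proof -
  have p: "x [^]\<^bsub>units_of G\<^esub> (n::nat) = x [^] n" for n
    by (induction n) (simp_all add: units_of_mult units_of_one nat_pow_def)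
  show ?thesis
    unfolding int_pow_def2 p units_of_inv[OF nat_pow_Units[OF assms]] ..
qed

lemma (in monoid) int_pow_Units: "x \<in> Units G \<Longrightarrow> x [^] (z::int) \<in> Units G"
  by (metis group.int_pow_closed int_pow_units_of units_group units_of_carrier)

lemma (in monoid) int_pow_Units_closed [simp]: "x \<in> Units G \<Longrightarrow> x [^] (z::int) \<in> carrier G"
  by (rule Units_closed[OF int_pow_Units])

lemma (in monoid) int_pow_Units_add:
  assumes "x \<in> Units G"
  shows "x [^] (y + z :: int) = x [^] y \<otimes> x [^] z"
  using group.int_pow_mult[OF units_group, of x y z] assms
  by (simp add: units_of_carrier units_of_mult int_pow_units_of)

lemma (in monoid) int_pow_Units_one:
  assumes "x \<in> Units G"
  shows "x [^] (1::int) = x"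
  using assms by (simp add: int_pow_def2 Units_closed)

lemma (in monoid) int_pow_Units_minus_one:
  assumes "x \<in> Units G"
  shows "x [^] (-1::int) = inv x"
  using assms by (simp add: int_pow_def2 Units_closed)

lemma (in monoid) nat_pow_inv_Units:
  assumes "x \<in> Units G"
  shows "inv x [^] (n::nat) = x [^] (- int n)"
  using group.nat_pow_inv[OF units_group, of x n] assms
proof -
  have p: "y [^]\<^bsub>units_of G\<^esub> (k::nat) = y [^] k" for k y
    by (induction k) (simp_all add: units_of_mult units_of_one nat_pow_def)
  show ?thesis
    using group.nat_pow_inv[OF units_group, of x n] assms
      group.int_pow_neg_int[OF units_group, of x n]
    by (simp add: units_of_carrier units_of_inv p int_pow_units_of[symmetric])
qed

lemma (in abelian_group) diff_eq_zero:
  assumes "a \<in> carrier G" "b \<in> carrier G"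
  shows "a \<ominus> b = \<zero> \<longleftrightarrow> a = b"
proof
  assume "a \<ominus> b = \<zero>"
  then have "(a \<oplus> \<ominus> b) \<oplus> b = b"
    using assms by (simp add: minus_eq)
  then show "a = b"
    using assms by (simp add: a_assoc l_neg)
qed (use assms in \<open>simp add: minus_eq r_neg\<close>)

locale scalar_ring = ring K for K :: "('a, 'b) ring_scheme" (structure) +
  fixes \<phi> :: "complex \<Rightarrow> 'a"
  assumes \<phi>_closed [simp]: "\<phi> c \<in> carrier K"
    and \<phi>_add: "\<phi> (c + d) = \<phi> c \<oplus> \<phi> d"
    and \<phi>_mult: "\<phi> (c * d) = \<phi> c \<otimes> \<phi> d"
    and \<phi>_one: "\<phi> 1 = \<one>"
    and \<phi>_central: "x \<in> carrier K \<Longrightarrow> x \<otimes> \<phi> c = \<phi> c \<otimes> x"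
begin

lemma \<phi>_zero: "\<phi> 0 = \<zero>"
  using \<phi>_add[of 0 0] by (metis \<phi>_closed add.l_cancel_one' add_0)

lemma \<phi>_lcomm: "x \<in> carrier K \<Longrightarrow> y \<in> carrier K \<Longrightarrow> x \<otimes> (\<phi> c \<otimes> y) = \<phi> c \<otimes> (x \<otimes> y)"
  by (metis \<phi>_central \<phi>_closed m_assoc)

inductive polyfun :: "(complex \<Rightarrow> 'a) \<Rightarrow> bool" where
  const: "x \<in> carrier K \<Longrightarrow> polyfun (\<lambda>a. x)"
| add: "polyfun G \<Longrightarrow> polyfun G' \<Longrightarrow> polyfun (\<lambda>a. G a \<oplus> G' a)"
| var: "polyfun G \<Longrightarrow> polyfun (\<lambda>a. \<phi> a \<otimes> G a)"

lemma polyfun_closed: "polyfun G \<Longrightarrow> G a \<in> carrier K"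
  by (induction rule: polyfun.induct) auto

lemma polyfun_mult:
  assumes "polyfun G" "polyfun G'"
  shows "polyfun (\<lambda>a. G a \<otimes> G' a)"
  using assms(1)
proof (induction rule: polyfun.induct)
  case (const x)
  show ?case using assms(2)
  proof (induction rule: polyfun.induct)
    case (const y)
    then show ?case using \<open>x \<in> carrier K\<close> by (intro polyfun.const) auto
  next
    case (add G G')
    then show ?case
      using polyfun.add[OF add.IH] \<open>x \<in> carrier K\<close> by (simp add: r_distr polyfun_closed)
  next
    case (var G)
    then show ?case
      using polyfun.var[OF var.IH] \<open>x \<in> carrier K\<close> by (simp add: \<phi>_lcomm polyfun_closed)
  qed
next
  case (add G1 G2)
  then show ?case
    using polyfun.add[OF add.IH] assms(2) by (simp add: l_distr polyfun_closed)
next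
  case (var G1)
  then show ?case
    using polyfun.var[OF var.IH] assms(2) by (simp add: m_assoc polyfun_closed)
qed

lemma polyfun_gchoose:
  assumes "x \<in> carrier K"
  shows "polyfun (\<lambda>a. \<phi> (a gchoose k) \<otimes> x)"
proof (induction k)
  case 0
  then show ?case using assms by (simp add: \<phi>_one polyfun.const)
next
  case (Suc k)
  let ?G = "\<lambda>a. \<phi> (1 / of_nat (Suc k)) \<otimes> (\<phi> a \<otimes> (\<phi> (a gchoose k) \<otimes> x)
    \<oplus> \<phi> (- of_nat k) \<otimes> (\<phi> (a gchoose k) \<otimes> x))"
  have "polyfun ?G"
    by (intro polyfun_mult polyfun.add polyfun.const polyfun.var Suc) simp_all
  moreover have "?G = (\<lambda>a. \<phi> (a gchoose Suc k) \<otimes> x)"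
  proof
    fix a :: complex
    have "(a gchoose Suc k) * of_nat (Suc k) = (a gchoose k) * (a - of_nat k)"
      using gbinomial_mult_1[of a k] by (simp add: algebra_simps)
    then have "a gchoose Suc k = (a gchoose k) * (a - of_nat k) / of_nat (Suc k)"
      by (metis nonzero_eq_divide_eq of_nat_neq_0)
    then have e: "a gchoose Suc k = (1 / of_nat (Suc k)) * ((a + - of_nat k) * (a gchoose k))"
      by simp
    show "?G a = \<phi> (a gchoose Suc k) \<otimes> x"
      unfolding e using assms by (simp only: \<phi>_mult \<phi>_add) (simp add: m_assoc l_distr r_distr)
  qed
  ultimately show ?case by simp
qed

definition newton :: "(complex \<Rightarrow> 'a) \<Rightarrow> bool" where
  "newton G \<longleftrightarrow> (\<exists>x d. (\<forall>k. x k \<in> carrier K) \<and>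
     (\<forall>D\<ge>d. \<forall>a. G a = (\<Oplus>k\<in>{..<D}. \<phi> (a gchoose k) \<otimes> x k)))"

lemma newton_add:
  assumes "newton G" "newton G'"
  shows "newton (\<lambda>a. G a \<oplus> G' a)"
proof -
  obtain x d where x: "\<And>k. x k \<in> carrier K"
    "\<And>D a. D \<ge> d \<Longrightarrow> G a = (\<Oplus>k\<in>{..<D}. \<phi> (a gchoose k) \<otimes> x k)"
    using assms(1) unfolding newton_def by blast
  obtain x' d' where x': "\<And>k. x' k \<in> carrier K"
    "\<And>D a. D \<ge> d' \<Longrightarrow> G' a = (\<Oplus>k\<in>{..<D}. \<phi> (a gchoose k) \<otimes> x' k)"
    using assms(2) unfolding newton_def by blast
  have "G a \<oplus> G' a = (\<Oplus>k\<in>{..<D}. \<phi> (a gchoose k) \<otimes> (x k \<oplus> x' k))" if "D \<ge> max d d'" for D a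
    using that by (simp add: x(2)[of D] x'(2)[of D] x(1) x'(1) r_distr finsum_addf)
  then show ?thesis
    unfolding newton_def using x(1) x'(1) by (intro exI[of _ "\<lambda>k. x k \<oplus> x' k"] exI[of _ "max d d'"]) auto
qed

lemma newton_basis:
  assumes "x \<in> carrier K"
  shows "newton (\<lambda>a. \<phi> (a gchoose k) \<otimes> x)"
proof -
  have "\<phi> (a gchoose k) \<otimes> x =
      (\<Oplus>j\<in>{..<D}. \<phi> (a gchoose j) \<otimes> (if k = j then x else \<zero>))" if "D \<ge> Suc k" for D a
  proof -
    have "(\<Oplus>j\<in>{..<D}. \<phi> (a gchoose j) \<otimes> (if k = j then x else \<zero>))
        = (\<Oplus>j\<in>{..<D}. if k = j then \<phi> (a gchoose j) \<otimes> x else \<zero>)"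
      using assms by (intro finsum_cong') auto
    also have "\<dots> = \<phi> (a gchoose k) \<otimes> x"
      using that assms by (intro finsum_singleton) auto
    finally show ?thesis by simp
  qed
  then show ?thesis
    unfolding newton_def using assms
    by (intro exI[of _ "\<lambda>j. if k = j then x else \<zero>"] exI[of _ "Suc k"]) auto
qed

lemma newton_sum:
  assumes "\<And>k. newton (G k)" "\<And>k a. G k a \<in> carrier K"
  shows "newton (\<lambda>a. \<Oplus>k\<in>{..<d::nat}. G k a)"
proof (induction d)
  case 0
  have "newton (\<lambda>a. \<phi> (a gchoose 0) \<otimes> \<zero>)" by (rule newton_basis) simp
  then show ?case by simp
next
  case (Suc d)
  then show ?case
    using newton_add[OF Suc assms(1)] assms(2) by (simp add: finsum_lessThan_Suc)
qed

lemma newton_polyfun: "polyfun G \<Longrightarrow> newton G"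
proof (induction rule: polyfun.induct)
  case (const x)
  have "newton (\<lambda>a. \<phi> (a gchoose 0) \<otimes> x)" using const by (rule newton_basis)
  then show ?case using const by (simp add: \<phi>_one)
next
  case (add G G')
  then show ?case by (intro newton_add)
next
  case (var G)
  obtain x d where x: "\<And>k. x k \<in> carrier K"
    "\<And>a. G a = (\<Oplus>k\<in>{..<d}. \<phi> (a gchoose k) \<otimes> x k)"
    using var.IH unfolding newton_def by blast
  let ?G = "\<lambda>k a. \<phi> (a gchoose k) \<otimes> (\<phi> (of_nat k) \<otimes> x k)
    \<oplus> \<phi> (a gchoose Suc k) \<otimes> (\<phi> (of_nat (Suc k)) \<otimes> x k)"
  have "newton (\<lambda>a. \<Oplus>k\<in>{..<d}. ?G k a)"
    by (intro newton_sum newton_add newton_basis) (simp_all add: x)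
  moreover have "(\<Oplus>k\<in>{..<d}. ?G k a) = \<phi> a \<otimes> G a" for a
  proof -
    have "\<phi> a \<otimes> (\<phi> (a gchoose k) \<otimes> x k) = ?G k a" for k
    proof -
      have "a * (a gchoose k) = (a gchoose k) * of_nat k + (a gchoose Suc k) * of_nat (Suc k)"
        using gbinomial_mult_1[of a k] by (simp add: algebra_simps)
      then have "\<phi> (a * (a gchoose k)) \<otimes> x k
          = \<phi> ((a gchoose k) * of_nat k + (a gchoose Suc k) * of_nat (Suc k)) \<otimes> x k"
        by simp
      then show ?thesis
        by (simp only: \<phi>_mult \<phi>_add) (simp add: x m_assoc l_distr)
    qed
    then show ?thesis
      by (simp add: x finsum_rdistr Pi_def cong: finsum_cong)
  qed
  ultimately show ?case by simp
qed

lemma polyfun_eq_zero: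
  assumes "polyfun G" "\<And>n::nat. G (of_nat n) = \<zero>"
  shows "G a = \<zero>"
proof -
  obtain x d where x: "\<And>k. x k \<in> carrier K"
    and G: "\<And>D a. D \<ge> d \<Longrightarrow> G a = (\<Oplus>k\<in>{..<D}. \<phi> (a gchoose k) \<otimes> x k)"
    using newton_polyfun[OF assms(1)] unfolding newton_def by blast
  have "x k = \<zero>" for k
  proof (induction k rule: less_induct)
    case (less k)
    have *: "\<phi> (of_nat k gchoose j) \<otimes> x j = (if k = j then x j else \<zero>)" for j
      using less[of j] x[of j]
      by (cases j k rule: linorder_cases)
        (simp_all add: binomial_gbinomial[symmetric] binomial_eq_0 \<phi>_zero \<phi>_one)
    have "\<zero> = (\<Oplus>j\<in>{..<max d (Suc k)}. \<phi> (of_nat k gchoose j) \<otimes> x j)"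
      using assms(2)[of k] G[of "max d (Suc k)"] by simp
    also have "\<dots> = (\<Oplus>j\<in>{..<max d (Suc k)}. if k = j then x j else \<zero>)"
      unfolding * ..
    also have "\<dots> = x k"
      using x by (intro finsum_singleton) auto
    finally show ?case by simp
  qed
  then show ?thesis
    by (simp add: G[OF order.refl] finsum_zero)
qed

lemma polyfun_eqI:
  assumes "polyfun G" "polyfun G'" "\<And>n::nat. G (of_nat n) = G' (of_nat n)"
  shows "G a = G' a"
proof -
  have "polyfun (\<lambda>a. G a \<oplus> (\<ominus> \<one>) \<otimes> G' a)"
    using assms(1,2) by (intro polyfun.intros polyfun_mult) auto
  then have "G a \<oplus> (\<ominus> \<one>) \<otimes> G' a = \<zero>"
    by (rule polyfun_eq_zero) (simp add: assms(3) polyfun_closed l_minus r_neg assms(2))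
  then have "G a \<ominus> G' a = \<zero>"
    using assms(1,2) by (simp add: polyfun_closed l_minus minus_eq)
  then show ?thesis
    using assms(1,2) by (simp add: polyfun_closed diff_eq_zero)
qed

lemma conj_power_newton:
  assumes f: "f \<in> Units K" and x: "\<And>i. x i \<in> carrier K"
    and step: "\<And>i. f \<otimes> x i \<otimes> inv f = x i \<oplus> x (Suc i)"
    and M: "x M = \<zero>"
  shows "f [^] n \<otimes> x 0 \<otimes> inv f [^] n = (\<Oplus>i\<in>{..<Suc M}. \<phi> (of_nat n gchoose i) \<otimes> x i)"
proof (induction n)
  case 0
  have *: "\<phi> (of_nat 0 gchoose i) \<otimes> x i = (if 0 = i then x i else \<zero>)" for i
    using x[of i] by (cases i) (simp_all add: \<phi>_one \<phi>_zero)
  have "(\<Oplus>i\<in>{..<Suc M}. \<phi> (of_nat 0 gchoose i) \<otimes> x i) = (\<Oplus>i\<in>{..<Suc M}. if 0 = i then x i else \<zero>)"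
    unfolding * ..
  also have "\<dots> = x 0"
    using x by (intro finsum_singleton) auto
  finally show ?case
    using x by simp
next
  case (Suc n)
  let ?g = "\<lambda>i. \<phi> (of_nat n gchoose i) \<otimes> x (Suc i)"
  let ?h = "\<lambda>i. \<phi> (if i = 0 then 0 else of_nat n gchoose (i - 1)) \<otimes> x i"
  have h: "finsum K ?h {..<Suc M} = finsum K ?g {..<M}"
    using finsum_lessThan_Suc_shift[of ?h M] x by (simp add: \<phi>_zero)
  have inc: "finsum K ?g {..<Suc M} = finsum K ?h {..<Suc M} \<oplus> ?g M"
    unfolding h using x by (subst finsum_lessThan_Suc) simp_all
  have fx: "f [^] Suc n \<otimes> x 0 \<otimes> inv f [^] Suc n
      = f \<otimes> (f [^] n \<otimes> x 0 \<otimes> inv f [^] n) \<otimes> inv f"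
    unfolding nat_pow_Suc2[OF Units_closed[OF f]] nat_pow_Suc[of "inv f"]
    using f x by (simp add: m_assoc Units_closed)
  have xM: "x (Suc M) = \<zero>"
    using step[of M] M f x by (simp add: Units_closed)
  have "f [^] Suc n \<otimes> x 0 \<otimes> inv f [^] Suc n
      = f \<otimes> (\<Oplus>i\<in>{..<Suc M}. \<phi> (of_nat n gchoose i) \<otimes> x i) \<otimes> inv f"
    unfolding fx Suc ..
  also have "\<dots> = (\<Oplus>i\<in>{..<Suc M}. f \<otimes> (\<phi> (of_nat n gchoose i) \<otimes> x i) \<otimes> inv f)"
    using f x by (simp add: finsum_rdistr finsum_ldistr Pi_def Units_closed)
  also have "\<dots> = (\<Oplus>i\<in>{..<Suc M}. \<phi> (of_nat n gchoose i) \<otimes> x i \<oplus> ?g i)"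
  proof -
    have "f \<otimes> (\<phi> (of_nat n gchoose i) \<otimes> x i) \<otimes> inv f = \<phi> (of_nat n gchoose i) \<otimes> x i \<oplus> ?g i" for i
    proof -
      have "f \<otimes> (\<phi> (of_nat n gchoose i) \<otimes> x i) \<otimes> inv f
          = \<phi> (of_nat n gchoose i) \<otimes> (f \<otimes> x i \<otimes> inv f)"
        using f x by (simp add: \<phi>_lcomm Units_closed m_assoc)
      then show ?thesis
        unfolding step using x by (simp add: r_distr)
    qed
    then show ?thesis by simp
  qed
  also have "\<dots> = (\<Oplus>i\<in>{..<Suc M}. \<phi> (of_nat n gchoose i) \<otimes> x i) \<oplus> finsum K ?h {..<Suc M}"
    using x xM inc by (simp add: finsum_addf finsum_closed Pi_def)
  also have "\<dots> = (\<Oplus>i\<in>{..<Suc M}. \<phi> (of_nat n gchoose i) \<otimes> x i \<oplus> ?h i)"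
    using x by (simp add: finsum_addf Pi_def)
  also have "\<dots> = (\<Oplus>i\<in>{..<Suc M}. \<phi> (of_nat (Suc n) gchoose i) \<otimes> x i)"
  proof -
    have "\<phi> (of_nat n gchoose i) \<otimes> x i \<oplus> ?h i = \<phi> (of_nat (Suc n) gchoose i) \<otimes> x i" for i
    proof (cases i)
      case 0
      then show ?thesis using x by (simp add: \<phi>_zero)
    next
      case (Suc j)
      have "of_nat (Suc n) gchoose i = (of_nat n gchoose i :: complex) + (of_nat n gchoose j)"
        using gbinomial_Suc_Suc[of "of_nat n :: complex" j] Suc by (simp add: add.commute)
      then show ?thesis
        using x Suc by (simp add: \<phi>_add l_distr)
    qed
    then show ?thesis by simp
  qed
  finally show ?case .
qed

end

section \<open>Complex conjugation in a localized Heisenberg algebra\<close>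

fun opp :: "node \<Rightarrow> node" where
  "opp N1 = N2"
| "opp N2 = N1"

fun sg :: "node \<Rightarrow> complex" where
  "sg N1 = 1"
| "sg N2 = - 1"

fun offset :: "node \<Rightarrow> int \<Rightarrow> int" where
  "offset N1 j = 1 - j"
| "offset N2 j = j"

lemma opp_opp [simp]: "opp (opp i) = i"
  by (cases i) simp_all

lemma list_prod_Nil [simp]: "list_prod G [] = \<one>\<^bsub>G\<^esub>"
  by (simp add: list_prod_def)

lemma list_prod_Cons [simp]: "list_prod G (x # xs) = x \<otimes>\<^bsub>G\<^esub> list_prod G xs"
  by (simp add: list_prod_def)

lemma (in monoid) list_prod_closed: "set xs \<subseteq> carrier G \<Longrightarrow> list_prod G xs \<in> carrier G"
  by (induction xs) auto

lemma (in monoid) list_prod_append: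
  "set xs \<subseteq> carrier G \<Longrightarrow> set ys \<subseteq> carrier G \<Longrightarrow>
    list_prod G (xs @ ys) = list_prod G xs \<otimes> list_prod G ys"
  by (induction xs) (simp_all add: list_prod_closed m_assoc)

lemma (in monoid) list_prod_upt_Suc:
  assumes "\<And>w. f w \<in> carrier G" "1 \<le> k"
  shows "list_prod G (map f [1..<Suc k]) = list_prod G (map f [1..<k]) \<otimes> f k"
  using assms by (simp add: list_prod_append image_subset_iff)

locale heisenberg_ring = scalar_ring +
  fixes F :: "node \<Rightarrow> 'a" and z :: 'a
  assumes F_Units [simp]: "F i \<in> Units K"
    and z_closed [simp]: "z \<in> carrier K"
    and z_comm: "F i \<otimes> z = z \<otimes> F i"
    and F_comm: "F N1 \<otimes> F N2 = F N2 \<otimes> F N1 \<oplus> z"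
    and H_Units': "\<And>u. F N2 \<otimes> F N1 \<oplus> \<phi> u \<otimes> z \<in> Units K"
begin

definition H :: "complex \<Rightarrow> 'a" where
  "H u = F N2 \<otimes> F N1 \<oplus> \<phi> u \<otimes> z"

lemma H_Units [simp]: "H u \<in> Units K"
  unfolding H_def by (rule H_Units')

lemma F_closed [simp]: "F i \<in> carrier K"
  by (simp add: Units_closed)

lemma H_closed [simp]: "H u \<in> carrier K"
  by (simp add: Units_closed)

lemma H_add: "H (u + v) = H u \<oplus> \<phi> v \<otimes> z"
  by (simp add: H_def \<phi>_add l_distr a_assoc)

lemma F_H: "F i \<otimes> H u = H (u + sg i) \<otimes> F i"
proof (cases i)
  case N1
  have "F N1 \<otimes> H u = (F N1 \<otimes> F N2) \<otimes> F N1 \<oplus> \<phi> u \<otimes> (F N1 \<otimes> z)"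
    by (simp add: H_def r_distr m_assoc \<phi>_lcomm)
  also have "\<dots> = H (u + 1) \<otimes> F N1"
    unfolding F_comm z_comm
    by (simp add: H_def l_distr r_distr m_assoc \<phi>_add \<phi>_one a_assoc) (simp add: a_comm)
  finally show ?thesis using N1 by simp
next
  case N2
  have "F N2 \<otimes> H u = F N2 \<otimes> (F N1 \<otimes> F N2 \<oplus> \<phi> (-1) \<otimes> z) \<oplus> \<phi> u \<otimes> (z \<otimes> F N2)"
  proof -
    have "z \<oplus> \<phi> (-1) \<otimes> z = (\<phi> 1 \<oplus> \<phi> (-1)) \<otimes> z"
      by (simp add: l_distr \<phi>_one del: r_neg)
    then have "z \<oplus> \<phi> (-1) \<otimes> z = \<zero>"
      unfolding \<phi>_add[symmetric] by (simp add: \<phi>_zero)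
    then have "F N1 \<otimes> F N2 \<oplus> \<phi> (-1) \<otimes> z = F N2 \<otimes> F N1"
      unfolding F_comm by (simp add: a_assoc)
    then show ?thesis
      unfolding z_comm[symmetric] by (simp add: H_def r_distr \<phi>_lcomm)
  qed
  also have "\<dots> = H (u + -1) \<otimes> F N2"
    by (simp only: H_def \<phi>_add) (simp add: l_distr r_distr m_assoc \<phi>_lcomm z_comm a_ac)
  finally show ?thesis using N2 by simp
qed

lemma z_H: "z \<otimes> H u = H u \<otimes> z"
proof -
  have "z \<otimes> H u = F N2 \<otimes> F N1 \<otimes> z \<oplus> \<phi> u \<otimes> z \<otimes> z"
    by (simp add: H_def r_distr \<phi>_lcomm m_assoc) (simp add: z_comm m_assoc[symmetric])
  also have "\<dots> = H u \<otimes> z"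
    by (simp add: H_def l_distr)
  finally show ?thesis .
qed

lemma H_comm: "H u \<otimes> H v = H v \<otimes> H u"
proof -
  have "H u \<otimes> H (u + (v - u)) = H (u + (v - u)) \<otimes> H u"
    unfolding H_add by (simp add: r_distr l_distr \<phi>_lcomm z_H m_assoc)
  then show ?thesis by simp
qed

inductive shift_family :: "(complex \<Rightarrow> 'a) \<Rightarrow> bool" where
  one: "shift_family (\<lambda>a. \<one>)"
| H: "shift_family P \<Longrightarrow> shift_family (\<lambda>a. H (u + a) \<otimes> P a)"
| inv: "shift_family P \<Longrightarrow> shift_family (\<lambda>a. inv (H (u + a)) \<otimes> P a)"

lemma shift_family_Units: "shift_family P \<Longrightarrow> P a \<in> Units K"
  by (induction rule: shift_family.induct) auto

lemma shift_family_closed: "shift_family P \<Longrightarrow> P a \<in> carrier K"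
  by (simp add: shift_family_Units Units_closed)

lemma shift_family_comm: "shift_family P \<Longrightarrow> H u \<otimes> P a = P a \<otimes> H u"
proof (induction rule: shift_family.induct)
  case (H P v)
  have "H u \<otimes> (H (v + a) \<otimes> P a) = H (v + a) \<otimes> (H u \<otimes> P a)"
    using H.hyps by (simp add: m_assoc[symmetric] H_comm shift_family_closed)
  then show ?case
    using H by (simp add: m_assoc shift_family_closed)
next
  case (inv P v)
  have "H u \<otimes> (inv (H (v + a)) \<otimes> P a) = inv (H (v + a)) \<otimes> (H u \<otimes> P a)"
    using inv.hyps commute_inv[of "H (v + a)" "H u"]
    by (simp add: m_assoc[symmetric] H_comm shift_family_closed)
  then show ?case
    using inv by (simp add: m_assoc shift_family_closed)
qed simp

lemma F_inv_H: "F i \<otimes> inv (H u) = inv (H (u + sg i)) \<otimes> F i"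
proof -
  have "F i \<otimes> inv (H u) = inv (H (u + sg i)) \<otimes> (H (u + sg i) \<otimes> F i) \<otimes> inv (H u)"
    by (simp add: m_assoc[symmetric])
  also have "\<dots> = inv (H (u + sg i)) \<otimes> F i"
    by (simp add: F_H[symmetric] m_assoc)
  finally show ?thesis .
qed

lemma F_shift_family: "shift_family P \<Longrightarrow> F i \<otimes> P a = P (a + sg i) \<otimes> F i"
proof (induction rule: shift_family.induct)
  case (H P u)
  have "F i \<otimes> (H (u + a) \<otimes> P a) = H (u + (a + sg i)) \<otimes> (F i \<otimes> P a)"
    using H.hyps by (simp add: m_assoc[symmetric] F_H shift_family_closed add.assoc)
  then show ?case
    using H by (simp add: m_assoc shift_family_closed)
next
  case (inv P u)
  have "F i \<otimes> (inv (H (u + a)) \<otimes> P a) = inv (H (u + (a + sg i))) \<otimes> (F i \<otimes> P a)"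
    using inv.hyps by (simp add: m_assoc[symmetric] F_inv_H shift_family_closed add.assoc)
  then show ?case
    using inv by (simp add: m_assoc shift_family_closed)
qed simp

lemma F_pow_shift_family:
  "shift_family P \<Longrightarrow> F i [^] (n::nat) \<otimes> P a = P (a + of_nat n * sg i) \<otimes> F i [^] n"
proof (induction n arbitrary: a)
  case (Suc n)
  have "F i [^] Suc n \<otimes> P a = (F i [^] n \<otimes> P (a + sg i)) \<otimes> F i"
    using Suc.prems by (simp add: m_assoc shift_family_closed F_shift_family)
  also have "\<dots> = P (a + of_nat (Suc n) * sg i) \<otimes> F i [^] Suc n"
    using Suc by (simp add: m_assoc shift_family_closed algebra_simps)
  finally show ?case .
qed (simp add: shift_family_closed)

lemma F_int_pow_shift_family:
  assumes P: "shift_family P"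
  shows "F i [^] (n::int) \<otimes> P a = P (a + of_int n * sg i) \<otimes> F i [^] n"
proof (cases n)
  case (nonneg k)
  then show ?thesis using F_pow_shift_family[OF P] by (simp add: int_pow_int)
next
  case (neg l)
  define k where "k = Suc l"
  have n: "n = - int k" using neg by (simp add: k_def)
  let ?b = "a + of_int n * sg i"
  have inv: "F i [^] n \<otimes> F i [^] k = \<one>" "F i [^] k \<otimes> F i [^] n = \<one>"
    using int_pow_Units_add[of "F i" n "int k"] int_pow_Units_add[of "F i" "int k" n] n by (simp_all add: int_pow_int)
  have "F i [^] n \<otimes> P a = F i [^] n \<otimes> (P (?b + of_nat k * sg i) \<otimes> F i [^] k) \<otimes> F i [^] n"
    using P inv(2) by (simp add: m_assoc shift_family_closed n)
  also have "\<dots> = (F i [^] n \<otimes> F i [^] k) \<otimes> P ?b \<otimes> F i [^] n"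
    unfolding F_pow_shift_family[OF P, symmetric] using P by (simp add: m_assoc shift_family_closed)
  also have "\<dots> = P ?b \<otimes> F i [^] n"
    unfolding inv using P by (simp add: shift_family_closed)
  finally show ?thesis .
qed

lemma shift_family_mult:
  assumes "shift_family P" "shift_family P'"
  shows "shift_family (\<lambda>a. P a \<otimes> P' a)"
  using assms(1)
proof (induction rule: shift_family.induct)
  case one
  then show ?case using assms(2) by (simp add: shift_family_closed)
next
  case (H P u)
  then show ?case
    using shift_family.H[OF H.IH] assms(2) by (simp add: m_assoc shift_family_closed)
next
  case (inv P u)
  then show ?case
    using shift_family.inv[OF inv.IH] assms(2) by (simp add: m_assoc shift_family_closed)
qed

lemma shift_family_list_prod:
  "(\<And>x. x \<in> set xs \<Longrightarrow> shift_family (P x)) \<Longrightarrow> shift_family (\<lambda>a. list_prod K (map (\<lambda>x. P x a) xs))"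
  by (induction xs) (auto intro: shift_family.one shift_family_mult)

lemma shift_family_upto_prod: "shift_family (\<lambda>a. upto_prod K N (\<lambda>k. H (u k + a)))"
proof (cases "N \<ge> 0")
  case True
  have "shift_family (\<lambda>a. H (u k + a))" for k
    using shift_family.H[OF shift_family.one, of "u k"] by simp
  then show ?thesis
    using True shift_family_list_prod[of "[1..N]" "\<lambda>k a. H (u k + a)"] by (simp add: upto_prod_def)
next
  case False
  have "shift_family (\<lambda>a. inv (H (u k + a)))" for k
    using shift_family.inv[OF shift_family.one, of "u k"] by simp
  then show ?thesis
    using False shift_family_list_prod[of "[N + 1..0]" "\<lambda>k a. inv (H (u k + a))"]
    by (simp add: upto_prod_def)
qed

lemma polyfun_H: "polyfun (\<lambda>a. H (u + s * a))"
proof -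
  have "polyfun (\<lambda>a. H u \<oplus> \<phi> s \<otimes> (\<phi> a \<otimes> z))"
    by (intro polyfun.add polyfun_mult polyfun.var polyfun.const) simp_all
  then show ?thesis
    unfolding H_add by (simp add: \<phi>_mult m_assoc)
qed

lemma shift_family_fraction:
  assumes "shift_family P"
  shows "\<exists>D E. (\<forall>a. D a \<in> Units K) \<and> (\<forall>a. D a \<otimes> P a = E a)
    \<and> (\<forall>a u. H u \<otimes> D a = D a \<otimes> H u)
    \<and> polyfun (\<lambda>a. D (s * a)) \<and> polyfun (\<lambda>a. E (s * a))"
  using assms
proof (induction rule: shift_family.induct)
  case one
  then show ?case
    by (intro exI[of _ "\<lambda>_. \<one>"]) (auto intro: polyfun.const)
next
  case (H P u)
  then obtain D E where DE: "\<And>a. D a \<in> Units K" "\<And>a. D a \<otimes> P a = E a"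
      "\<And>a u. H u \<otimes> D a = D a \<otimes> H u"
    and pf: "polyfun (\<lambda>a. D (s * a))" "polyfun (\<lambda>a. E (s * a))"
    by blast
  have "D a \<otimes> (H (u + a) \<otimes> P a) = H (u + a) \<otimes> E a" for a
  proof -
    have "D a \<otimes> (H (u + a) \<otimes> P a) = (H (u + a) \<otimes> D a) \<otimes> P a"
      unfolding DE(3) using H.hyps DE(1) by (simp add: m_assoc shift_family_closed Units_closed)
    then show ?thesis
      using H.hyps DE(1) by (simp add: m_assoc shift_family_closed Units_closed DE(2))
  qed
  then show ?case
    using DE pf polyfun_mult[OF polyfun_H pf(2), of u]
    by (intro exI[of _ D] exI[of _ "\<lambda>a. H (u + a) \<otimes> E a"]) simp
next
  case (inv P u)
  then obtain D E where DE: "\<And>a. D a \<in> Units K" "\<And>a. D a \<otimes> P a = E a"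
      "\<And>a u. H u \<otimes> D a = D a \<otimes> H u"
    and pf: "polyfun (\<lambda>a. D (s * a))" "polyfun (\<lambda>a. E (s * a))"
    by blast
  have "D a \<otimes> H (u + a) \<otimes> (inv (H (u + a)) \<otimes> P a) = E a" for a
  proof -
    have "D a \<otimes> H (u + a) \<otimes> (inv (H (u + a)) \<otimes> P a)
        = D a \<otimes> (H (u + a) \<otimes> inv (H (u + a))) \<otimes> P a"
      using inv.hyps DE(1) by (simp add: m_assoc shift_family_closed Units_closed del: Units_r_inv)
    then show ?thesis
      using DE(1) by (simp add: Units_closed DE(2))
  qed
  moreover have "H v \<otimes> (D a \<otimes> H (u + a)) = D a \<otimes> H (u + a) \<otimes> H v" for a v
  proof -
    have "H v \<otimes> (D a \<otimes> H (u + a)) = (D a \<otimes> H v) \<otimes> H (u + a)"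
      using DE(1) by (simp add: m_assoc[symmetric] Units_closed DE(3))
    then show ?thesis
      using DE(1) by (simp add: m_assoc Units_closed H_comm[of v])
  qed
  ultimately show ?case
    using DE pf polyfun_mult[OF pf(1) polyfun_H, of u]
    by (intro exI[of _ "\<lambda>a. D a \<otimes> H (u + a)"] exI[of _ E]) simp
qed

text \<open>
  At \<open>a = n \<in> \<nat>\<close> the sum is the expansion of conjugation by \<open>F i ^ n\<close>, and both sides are, after
  clearing denominators, polynomial in \<open>a\<close>.
\<close>

lemma complex_conj_shift_family:
  assumes P: "shift_family P"
    and X: "X = P 0 \<otimes> F i [^] N"
    and nil: "(ad K (F i) ^^ M) X = \<zero>"
  shows "(\<Oplus>j\<in>{..<Suc M}. \<phi> (a gchoose j) \<otimes> (ad K (F i) ^^ j) X \<otimes> F i [^] (s - int j))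
    = P (sg i * a) \<otimes> F i [^] (N + s)"
proof -
  let ?f = "F i"
  define x where "x j = (ad K ?f ^^ j) X \<otimes> ?f [^] (- N - int j)" for j
  have X_closed: "X \<in> carrier K"
    using P by (simp add: X shift_family_closed)
  have ad_closed: "(ad K ?f ^^ j) X \<in> carrier K" for j
    by (induction j) (simp_all add: X_closed ad_def)
  have x_closed: "x j \<in> carrier K" for j
    by (simp add: x_def ad_closed)
  have split: "?f [^] (- N - int j) = ?f \<otimes> ?f [^] (- N - int (Suc j))" for j
    using int_pow_Units_add[of ?f 1 "- N - int (Suc j)"] by (simp add: int_pow_Units_one)
  have split': "?f [^] (- N - int (Suc j)) = ?f [^] (- N - int j) \<otimes> inv ?f" for j
  proof -
    have "- N - int (Suc j) = (- N - int j) + -1" by simp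
    then show ?thesis
      by (simp only: int_pow_Units_add[OF F_Units] int_pow_Units_minus_one[OF F_Units])
  qed
  have step: "?f \<otimes> x j \<otimes> inv ?f = x j \<oplus> x (Suc j)" for j
  proof -
    let ?y = "(ad K ?f ^^ j) X" and ?p = "?f [^] (- N - int (Suc j))"
    have "?f \<otimes> x j \<otimes> inv ?f = (?f \<otimes> ?y) \<otimes> ?p"
      by (simp add: x_def m_assoc ad_closed split'[symmetric] del: of_nat_Suc)
    also have "\<dots> = (?y \<otimes> ?f \<oplus> (?f \<otimes> ?y \<ominus> ?y \<otimes> ?f)) \<otimes> ?p"
      using ad_closed[of j] by (simp add: minus_eq a_lcomm r_neg)
    also have "\<dots> = ?y \<otimes> (?f \<otimes> ?p) \<oplus> x (Suc j)"
      by (simp add: l_distr ad_closed m_assoc x_def ad_def del: of_nat_Suc)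
    also have "\<dots> = x j \<oplus> x (Suc j)"
      by (simp add: x_def split[symmetric] del: of_nat_Suc)
    finally show ?thesis .
  qed
  have x0: "x 0 = P 0"
    using int_pow_Units_add[of ?f N "- N", symmetric] P by (simp add: x_def X m_assoc shift_family_closed)
  have xM: "x M = \<zero>"
    by (simp add: x_def nil)
  define T where "T a = (\<Oplus>j\<in>{..<Suc M}. \<phi> (a gchoose j) \<otimes> x j)" for a
  have T_closed: "T a \<in> carrier K" for a
    unfolding T_def by (intro finsum_closed) (simp add: x_closed)
  have "polyfun T"
  proof -
    have "polyfun (\<lambda>a. \<Oplus>j\<in>{..<d::nat}. \<phi> (a gchoose j) \<otimes> x j)" for d
    proof (induction d)
      case (Suc d)
      then show ?case
        using polyfun.add[OF Suc polyfun_gchoose[OF x_closed]]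
        by (simp add: finsum_lessThan_Suc x_closed)
    qed (simp add: polyfun.const)
    then show ?thesis unfolding T_def .
  qed
  have nat: "T (of_nat n) = P (sg i * of_nat n)" for n
  proof -
    have "T (of_nat n) = (?f [^] n \<otimes> P 0) \<otimes> inv ?f [^] n"
      using conj_power_newton[of ?f x M n] by (simp add: T_def x_closed step xM x0)
    also have "\<dots> = P (sg i * of_nat n) \<otimes> (?f [^] int n \<otimes> ?f [^] (- int n))"
      using P by (simp add: F_pow_shift_family shift_family_closed m_assoc mult.commute
          nat_pow_inv_Units int_pow_int)
    also have "?f [^] int n \<otimes> ?f [^] (- int n) = \<one>"
      using int_pow_Units_add[of ?f "int n" "- int n"] by simp
    finally show ?thesis
      using P by (simp add: shift_family_closed)
  qed
  obtain D E where D: "\<And>a. D a \<in> Units K" and DP: "\<And>a. D a \<otimes> P a = E a"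
    and pf: "polyfun (\<lambda>a. D (sg i * a))" "polyfun (\<lambda>a. E (sg i * a))"
    using shift_family_fraction[OF P, of "sg i"] by blast
  have "D (sg i * a) \<otimes> T a = E (sg i * a)"
    by (rule polyfun_eqI[OF polyfun_mult[OF pf(1) \<open>polyfun T\<close>] pf(2)]) (simp add: nat DP)
  then have T: "T a = P (sg i * a)"
    using D P by (simp add: DP[symmetric] T_closed shift_family_closed)
  have "(\<Oplus>j\<in>{..<Suc M}. \<phi> (a gchoose j) \<otimes> (ad K ?f ^^ j) X \<otimes> ?f [^] (s - int j))
      = (\<Oplus>j\<in>{..<Suc M}. \<phi> (a gchoose j) \<otimes> x j \<otimes> ?f [^] (N + s))"
  proof -
    have "?f [^] (s - int j) = ?f [^] (- N - int j) \<otimes> ?f [^] (N + s)" for j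
      using int_pow_Units_add[of ?f "- N - int j" "N + s"] by simp
    then have "\<phi> (a gchoose j) \<otimes> (ad K ?f ^^ j) X \<otimes> ?f [^] (s - int j)
        = \<phi> (a gchoose j) \<otimes> x j \<otimes> ?f [^] (N + s)" for j
      by (simp add: x_def m_assoc ad_closed)
    then show ?thesis by simp
  qed
  also have "\<dots> = T a \<otimes> ?f [^] (N + s)"
    unfolding T_def by (subst finsum_ldistr) (simp_all add: x_closed Pi_def)
  finally show ?thesis by (simp add: T)
qed

lemma F_opp_F: "F (opp i) \<otimes> F i = H (of_int (offset i 1))"
  by (cases i) (simp_all add: H_def F_comm \<phi>_one \<phi>_zero)

lemma F_F_opp: "F i \<otimes> F (opp i) = H (of_int (offset i 0))"
  by (cases i) (simp_all add: H_def F_comm \<phi>_one \<phi>_zero)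

lemma shift_family_H: "shift_family (\<lambda>a. H (u + a))"
  using shift_family.H[OF shift_family.one] by simp

lemma shift_family_inv_H: "shift_family (\<lambda>a. inv (H (u + a)))"
  using shift_family.inv[OF shift_family.one] by simp

lemma offset_add: "of_int (offset i (j + k)) = of_int (offset i j) + of_int k * sg (opp i)"
  by (cases i) simp_all

lemma upto_prod_nonneg: "upto_prod K (int n) (\<lambda>j. H (of_int (offset i j))) = F (opp i) [^] n \<otimes> F i [^] n"
proof (induction n)
  case (Suc n)
  let ?P = "upto_prod K (int n) (\<lambda>j. H (of_int (offset i j)))" and ?H = "H (of_int (offset i (1 + int n)))"
  have P: "?P \<in> carrier K" "?H \<otimes> ?P = ?P \<otimes> ?H"
    using shift_family_closed[OF shift_family_upto_prod[of "int n" "\<lambda>j. of_int (offset i j)"], of 0]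
      shift_family_comm[OF shift_family_upto_prod[of "int n" "\<lambda>j. of_int (offset i j)"], of _ 0]
    by simp_all
  have "upto_prod K (int (Suc n)) (\<lambda>j. H (of_int (offset i j))) = ?P \<otimes> ?H"
    by (simp add: upto_prod_def upto_rec2 list_prod_append image_subset_iff add.commute)
  also have "\<dots> = (?H \<otimes> F (opp i) [^] n) \<otimes> F i [^] n"
    unfolding P(2)[symmetric] by (simp add: Suc m_assoc)
  also have "?H \<otimes> F (opp i) [^] n = F (opp i) [^] n \<otimes> H (of_int (offset i 1))"
    using F_pow_shift_family[OF shift_family_H[of 0], of "opp i" n "of_int (offset i 1)"]
    by (simp only: offset_add) simp
  also have "F (opp i) [^] n \<otimes> H (of_int (offset i 1)) \<otimes> F i [^] n
      = F (opp i) [^] Suc n \<otimes> F i [^] Suc n"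
    unfolding F_opp_F[symmetric] nat_pow_Suc2[OF F_closed[of i]] by (simp add: m_assoc)
  finally show ?case .
qed (simp add: upto_prod_def)

lemma upto_prod_neg:
  "upto_prod K (- int n) (\<lambda>j. H (of_int (offset i j))) = F (opp i) [^] (- int n) \<otimes> F i [^] (- int n)"
proof (induction n)
  case (Suc n)
  let ?P = "upto_prod K (- int n) (\<lambda>j. H (of_int (offset i j)))"
    and ?H = "inv (H (of_int (offset i (0 + - int n))))"
  have "upto_prod K (- int (Suc n)) (\<lambda>j. H (of_int (offset i j))) = ?H \<otimes> ?P"
    by (cases n) (simp_all add: upto_prod_def upto_rec1)
  also have "\<dots> = (?H \<otimes> F (opp i) [^] (- int n)) \<otimes> F i [^] (- int n)"
    unfolding Suc by (simp add: m_assoc)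
  also have "?H \<otimes> F (opp i) [^] (- int n) = F (opp i) [^] (- int n) \<otimes> inv (H (of_int (offset i 0)))"
    using F_int_pow_shift_family[OF shift_family_inv_H[of 0], of "opp i" "- int n" "of_int (offset i 0)"]
    by (simp only: offset_add) simp
  also have "inv (H (of_int (offset i 0))) = inv (F (opp i)) \<otimes> inv (F i)"
    unfolding F_F_opp[symmetric] by (simp add: inv_mult_Units)
  also have "F (opp i) [^] (- int n) \<otimes> (inv (F (opp i)) \<otimes> inv (F i)) \<otimes> F i [^] (- int n)
      = F (opp i) [^] (- int (Suc n)) \<otimes> F i [^] (- int (Suc n))"
  proof -
    have "- int (Suc n) = - int n + -1" by simp
    then have "F (opp i) [^] (- int (Suc n)) = F (opp i) [^] (- int n) \<otimes> inv (F (opp i))"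
      by (simp only: int_pow_Units_add[OF F_Units] int_pow_Units_minus_one[OF F_Units])
    moreover have "- int (Suc n) = -1 + - int n" by simp
    then have "F i [^] (- int (Suc n)) = inv (F i) \<otimes> F i [^] (- int n)"
      by (simp only: int_pow_Units_add[OF F_Units] int_pow_Units_minus_one[OF F_Units])
    ultimately show ?thesis by (simp add: m_assoc del: of_nat_Suc)
  qed
  finally show ?case .
qed (simp add: upto_prod_def)

lemma F_opp_int_pow:
  "F (opp i) [^] e = upto_prod K e (\<lambda>j. H (of_int (offset i j))) \<otimes> F i [^] (- e)"
proof -
  have "upto_prod K e (\<lambda>j. H (of_int (offset i j))) = F (opp i) [^] e \<otimes> F i [^] e"
    by (cases e rule: int_cases2) (simp_all add: upto_prod_nonneg upto_prod_neg int_pow_int)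
  then show ?thesis
    using int_pow_Units_add[of "F i" e "- e", symmetric] by (simp add: m_assoc)
qed

lemma word_product:
  assumes nd: "\<And>k. nd (Suc k) = opp (nd k)"
    and base: "X 1 = F (nd 0) [^] e 1"
    and step: "\<And>k P N. k \<ge> 1 \<Longrightarrow> shift_family P \<Longrightarrow> X k = P 0 \<otimes> F (nd k) [^] N \<Longrightarrow>
      X (Suc k) = P (sg (nd k) * a k) \<otimes> F (nd k) [^] (N + s k)"
    and e: "\<And>k. k \<ge> 1 \<Longrightarrow> e (Suc k) = s k - e k"
    and "k \<ge> (1::nat)"
  shows "X k = list_prod K (map (\<lambda>w. upto_prod K (e w)
      (\<lambda>j. H (of_int (offset (nd w) j) + (\<Sum>i=w..<k. sg (nd i) * a i)))) [1..<k])
    \<otimes> F (nd (k - 1)) [^] e k"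
  using \<open>k \<ge> 1\<close>
proof (induction k rule: nat_induct_at_least)
  case base
  then show ?case by (simp add: assms(2)[unfolded One_nat_def])
next
  case (Suc k)
  let ?u = "\<lambda>w k. \<Sum>i=w..<k. sg (nd i) * a i"
  let ?U = "\<lambda>w k t. upto_prod K (e w) (\<lambda>j. H (of_int (offset (nd w) j) + ?u w k + t))"
  let ?P = "\<lambda>t. list_prod K (map (\<lambda>w. ?U w k t) [1..<k])"
  have U: "shift_family (?U w k)" for w k
    by (rule shift_family_upto_prod)
  have P: "shift_family ?P"
    by (rule shift_family_list_prod) (rule U)
  have "nd (k - 1) = opp (nd k)"
    using nd[of "k - 1"] Suc.hyps by simp
  then have "X k = ?P 0 \<otimes> (?U k k 0 \<otimes> F (nd k) [^] (- e k))"
    using Suc.IH F_opp_int_pow[of "nd k" "e k"] by simp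
  also have "\<dots> = (?P 0 \<otimes> ?U k k 0) \<otimes> F (nd k) [^] (- e k)"
    using shift_family_closed[OF P, of 0] shift_family_closed[OF U, of k k 0]
    by (intro m_assoc[symmetric]) simp_all
  finally have "X (Suc k) = (?P (sg (nd k) * a k) \<otimes> ?U k k (sg (nd k) * a k))
      \<otimes> F (nd k) [^] (- e k + s k)"
    using step[OF Suc.hyps shift_family_mult[OF P U]] by blast
  also have "?P (sg (nd k) * a k) = list_prod K (map (\<lambda>w. ?U w (Suc k) 0) [1..<k])"
    by (intro arg_cong[of _ _ "list_prod K"] map_cong) (simp_all add: add.assoc)
  also have "?U k k (sg (nd k) * a k) = ?U k (Suc k) 0"
    by simp
  also have "list_prod K (map (\<lambda>w. ?U w (Suc k) 0) [1..<k]) \<otimes> ?U k (Suc k) 0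
      = list_prod K (map (\<lambda>w. ?U w (Suc k) 0) [1..<Suc k])"
    by (rule list_prod_upt_Suc[OF shift_family_closed[OF U] Suc.hyps, symmetric])
  finally show ?case
    using e[OF Suc.hyps] by (simp add: add.commute)
qed

end

section \<open>Enveloping algebras\<close>

lemma poly_mapping_add_induct [case_names zero add]:
  assumes "P 0"
    and "\<And>k c u. k \<notin> Poly_Mapping.keys u \<Longrightarrow> c \<noteq> 0 \<Longrightarrow> P u \<Longrightarrow> P (Poly_Mapping.single k c + u)"
  shows "P (u :: 'a \<Rightarrow>\<^sub>0 'b::monoid_add)"
proof (induction u rule: update_induct)
  case (update u k c)
  have "Poly_Mapping.update k c u = Poly_Mapping.single k c + u"
    using update.hyps(1)
    by (intro poly_mapping_eqI) (auto simp: lookup_update lookup_add lookup_single when_def in_keys_iff)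
  then show ?case using assms(2) update by simp
qed (rule assms(1))

lemma free_algebra_simps:
  "carrier (free_algebra X) = {u. \<forall>w \<in> Poly_Mapping.keys u. set (letters w) \<subseteq> X}"
  "mult (free_algebra X) = (*)" "one (free_algebra X) = 1"
  "zero (free_algebra X) = 0" "add (free_algebra X) = (+)"
  by (simp_all only: free_algebra_def partial_object.simps monoid.simps ring.simps)

lemma free_algebra_uminus:
  assumes "u \<in> carrier (free_algebra X)"
  shows "\<ominus>\<^bsub>free_algebra X\<^esub> u = - u"
proof -
  interpret ring "free_algebra X" by (rule ring_free_algebra)
  show ?thesis
    using assms by (intro minus_equality) (simp_all add: free_algebra_simps)
qed

lemma free_algebra_minus:
  assumes "u \<in> carrier (free_algebra X)" "v \<in> carrier (free_algebra X)"
  shows "u \<ominus>\<^bsub>free_algebra X\<^esub> v = u - v"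
  unfolding a_minus_def free_algebra_uminus[OF assms(2)] by (simp add: free_algebra_simps)

lemma single_in_free_algebra:
  "set (letters w) \<subseteq> X \<Longrightarrow> Poly_Mapping.single w c \<in> carrier (free_algebra X)"
  by (simp add: free_algebra_simps)

lemma const_in_free_algebra: "Poly_Mapping.single 0 c \<in> carrier (free_algebra X)"
  by (simp add: single_in_free_algebra zero_word_def)

lemma letter_in_free_algebra: "x \<in> X \<Longrightarrow> letter x \<in> carrier (free_algebra X)"
  by (simp add: letter_def single_in_free_algebra)

lemma const_mult_commute:
  fixes u :: "'a word \<Rightarrow>\<^sub>0 complex"
  shows "Poly_Mapping.single 0 c * u = u * Poly_Mapping.single 0 c"
  by (induction u rule: poly_mapping_add_induct)
    (simp_all add: distrib_left distrib_right mult_single mult.commute)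

lemma single_word_Cons:
  "Poly_Mapping.single (Word (x # xs)) c = letter x * Poly_Mapping.single (Word xs) c"
  by (simp add: letter_def mult_single plus_word_def)

lemma free_algebra_induct [consumes 1, case_names zero add const letter]:
  assumes "u \<in> carrier (free_algebra X)"
    and "P 0"
    and "\<And>u v. u \<in> carrier (free_algebra X) \<Longrightarrow> v \<in> carrier (free_algebra X) \<Longrightarrow> P u \<Longrightarrow> P v \<Longrightarrow> P (u + v)"
    and "\<And>c. P (Poly_Mapping.single 0 c)"
    and "\<And>x u. x \<in> X \<Longrightarrow> u \<in> carrier (free_algebra X) \<Longrightarrow> P u \<Longrightarrow> P (letter x * u)"
  shows "P u"
proof -
  have single: "P (Poly_Mapping.single (Word xs) c)" if "set xs \<subseteq> X" for xs c
    using that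
  proof (induction xs)
    case Nil
    then show ?case using assms(4)[of c] by (simp add: zero_word_def)
  next
    case (Cons x xs)
    then show ?case
      using assms(5)[of x "Poly_Mapping.single (Word xs) c"]
      by (simp add: single_word_Cons single_in_free_algebra)
  qed
  show ?thesis
    using assms(1)
  proof (induction u rule: poly_mapping_add_induct)
    case (add w c u)
    have "Poly_Mapping.keys (Poly_Mapping.single w c + u) = insert w (Poly_Mapping.keys u)"
      using add.hyps by (auto simp: in_keys_iff lookup_add lookup_single when_def split: if_splits)
    then have w: "set (letters w) \<subseteq> X" and u: "u \<in> carrier (free_algebra X)"
      using add.prems by (auto simp: free_algebra_simps)
    show ?case
      using assms(3)[OF single_in_free_algebra[OF w] u] single[of "letters w" c] w u add.IH by simp
  qed (rule assms(2))
qed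

locale lie_closed =
  fixes L :: "'a lie"
  assumes lie_add_closed: "x \<in> carrier L \<Longrightarrow> y \<in> carrier L \<Longrightarrow> lie_add L x y \<in> carrier L"
    and lie_scale_closed: "x \<in> carrier L \<Longrightarrow> lie_scale L c x \<in> carrier L"
    and lie_bracket_closed: "x \<in> carrier L \<Longrightarrow> y \<in> carrier L \<Longrightarrow> lie_bracket L x y \<in> carrier L"
begin

abbreviation "rels \<equiv>
  {letter (lie_add L x y) - (letter x + letter y) | x y. x \<in> carrier L \<and> y \<in> carrier L}
  \<union> {letter (lie_scale L c x) - Poly_Mapping.single 0 c * letter x | c x. x \<in> carrier L}
  \<union> {letter x * letter y - letter y * letter x - letter (lie_bracket L x y)
      | x y. x \<in> carrier L \<and> y \<in> carrier L}"

sublocale FA: ring "free_algebra (carrier L)"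
  by (rule ring_free_algebra)

lemma free_closed:
  "u \<in> carrier (free_algebra (carrier L)) \<Longrightarrow> v \<in> carrier (free_algebra (carrier L)) \<Longrightarrow>
    u + v \<in> carrier (free_algebra (carrier L))"
  "u \<in> carrier (free_algebra (carrier L)) \<Longrightarrow> v \<in> carrier (free_algebra (carrier L)) \<Longrightarrow>
    u - v \<in> carrier (free_algebra (carrier L))"
  "u \<in> carrier (free_algebra (carrier L)) \<Longrightarrow> v \<in> carrier (free_algebra (carrier L)) \<Longrightarrow>
    u * v \<in> carrier (free_algebra (carrier L))"
  using FA.a_closed[of u v] FA.minus_closed[of u v] FA.m_closed[of u v]
  by (simp_all only: free_algebra_minus free_algebra_simps(2,5))

lemma rels_closed: "rels \<subseteq> carrier (free_algebra (carrier L))"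
  by (auto intro!: free_closed letter_in_free_algebra const_in_free_algebra
      lie_add_closed lie_scale_closed lie_bracket_closed)

lemma ideal_env_ideal: "ideal (env_ideal L) (free_algebra (carrier L))"
  unfolding env_ideal_def by (rule FA.genideal_ideal[OF rels_closed])

sublocale env: ring "env L"
  unfolding env_def by (rule ideal.quotient_is_ring[OF ideal_env_ideal])

definition proj :: "('a word \<Rightarrow>\<^sub>0 complex) \<Rightarrow> ('a word \<Rightarrow>\<^sub>0 complex) set" where
  "proj u = env_ideal L +>\<^bsub>free_algebra (carrier L)\<^esub> u"

lemma proj_hom: "proj \<in> ring_hom (free_algebra (carrier L)) (env L)"
  unfolding proj_def env_def by (rule ideal.rcos_ring_hom[OF ideal_env_ideal])

lemma proj_closed: "u \<in> carrier (free_algebra (carrier L)) \<Longrightarrow> proj u \<in> carrier (env L)"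
  using ring_hom_closed[OF proj_hom] .

lemma proj_ops:
  assumes "u \<in> carrier (free_algebra (carrier L))" "v \<in> carrier (free_algebra (carrier L))"
  shows "proj (u + v) = proj u \<oplus>\<^bsub>env L\<^esub> proj v"
    and "proj (u * v) = proj u \<otimes>\<^bsub>env L\<^esub> proj v"
    and "proj (u - v) = proj u \<ominus>\<^bsub>env L\<^esub> proj v"
proof -
  interpret ring_hom_ring "free_algebra (carrier L)" "env L" proj
    using proj_hom by unfold_locales
  show "proj (u + v) = proj u \<oplus>\<^bsub>env L\<^esub> proj v"
    using hom_add[OF assms] by (simp add: free_algebra_simps)
  show "proj (u * v) = proj u \<otimes>\<^bsub>env L\<^esub> proj v"
    using hom_mult[OF assms] by (simp add: free_algebra_simps)
  show "proj (u - v) = proj u \<ominus>\<^bsub>env L\<^esub> proj v"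
    using assms hom_add[OF assms(1) FA.a_inv_closed[OF assms(2)]] hom_a_inv[OF assms(2)]
    unfolding free_algebra_minus[OF assms, symmetric] by (simp add: a_minus_def)
qed

lemma proj_one: "proj 1 = \<one>\<^bsub>env L\<^esub>"
  using ring_hom_one[OF proj_hom] by (simp add: free_algebra_simps)

lemma proj_zero: "proj 0 = \<zero>\<^bsub>env L\<^esub>"
proof -
  have "proj (1 - 1) = \<one>\<^bsub>env L\<^esub> \<ominus>\<^bsub>env L\<^esub> \<one>\<^bsub>env L\<^esub>"
    unfolding proj_one[symmetric] by (rule proj_ops(3)) (use FA.one_closed in \<open>simp_all add: free_algebra_simps(3)\<close>)
  then show ?thesis by (simp add: a_minus_def env.r_neg)
qed

lemma proj_eq_iff:
  assumes "u \<in> carrier (free_algebra (carrier L))" "v \<in> carrier (free_algebra (carrier L))"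
  shows "proj u = proj v \<longleftrightarrow> u - v \<in> env_ideal L"
  using FA.quotient_eq_iff_same_a_r_cos[OF ideal_env_ideal assms]
  by (simp add: proj_def free_algebra_minus[OF assms])

lemma proj_surj:
  assumes "r \<in> carrier (env L)"
  obtains u where "u \<in> carrier (free_algebra (carrier L))" "r = proj u"
  using assms by (auto simp: env_def FactRing_def A_RCOSETS_def' proj_def)

lemma env_gen_proj: "env_gen L x = proj (letter x)"
  by (simp add: env_gen_def proj_def)

lemma env_const_proj: "env_const L c = proj (Poly_Mapping.single 0 c)"
  by (simp add: env_const_def proj_def)

lemma env_gen_closed: "x \<in> carrier L \<Longrightarrow> env_gen L x \<in> carrier (env L)"
  by (simp add: env_gen_proj proj_closed letter_in_free_algebra)

lemma env_const_closed: "env_const L c \<in> carrier (env L)"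
  by (simp add: env_const_proj proj_closed const_in_free_algebra)

lemma rel_in_env_ideal: "r \<in> rels \<Longrightarrow> r \<in> env_ideal L"
  unfolding env_ideal_def by (rule subsetD[OF FA.genideal_self[OF rels_closed]])

lemma env_gen_add:
  assumes "x \<in> carrier L" "y \<in> carrier L"
  shows "env_gen L (lie_add L x y) = env_gen L x \<oplus>\<^bsub>env L\<^esub> env_gen L y"
proof -
  have "proj (letter (lie_add L x y)) = proj (letter x + letter y)"
  proof (subst proj_eq_iff)
    show "letter (lie_add L x y) - (letter x + letter y) \<in> env_ideal L"
      using assms by (intro rel_in_env_ideal) blast
  qed (intro free_closed letter_in_free_algebra lie_add_closed assms)+
  then show ?thesis
    using assms by (simp add: env_gen_proj proj_ops letter_in_free_algebra)
qed

lemma env_gen_scale: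
  assumes "x \<in> carrier L"
  shows "env_gen L (lie_scale L c x) = env_const L c \<otimes>\<^bsub>env L\<^esub> env_gen L x"
proof -
  have "proj (letter (lie_scale L c x)) = proj (Poly_Mapping.single 0 c * letter x)"
  proof (subst proj_eq_iff)
    show "letter (lie_scale L c x) - Poly_Mapping.single 0 c * letter x \<in> env_ideal L"
      using assms by (intro rel_in_env_ideal) blast
  qed (intro free_closed letter_in_free_algebra const_in_free_algebra lie_scale_closed assms)+
  then show ?thesis
    using assms by (simp add: env_gen_proj env_const_proj proj_ops letter_in_free_algebra const_in_free_algebra)
qed

lemma env_gen_bracket:
  assumes "x \<in> carrier L" "y \<in> carrier L"
  shows "env_gen L (lie_bracket L x y) = ad (env L) (env_gen L x) (env_gen L y)"
proof -
  have c: "letter x * letter y - letter y * letter x \<in> carrier (free_algebra (carrier L))"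
    using assms by (intro free_closed letter_in_free_algebra)
  have "proj (letter x * letter y - letter y * letter x) = proj (letter (lie_bracket L x y))"
  proof (subst proj_eq_iff)
    show "letter x * letter y - letter y * letter x - letter (lie_bracket L x y) \<in> env_ideal L"
      using assms by (intro rel_in_env_ideal) blast
  qed (intro c letter_in_free_algebra lie_bracket_closed assms)+
  then show ?thesis
    using assms by (simp add: ad_def env_gen_proj proj_ops letter_in_free_algebra free_closed)
qed

lemma env_const_add: "env_const L (c + d) = env_const L c \<oplus>\<^bsub>env L\<^esub> env_const L d"
  by (simp add: env_const_proj single_add proj_ops const_in_free_algebra)

lemma env_const_mult: "env_const L (c * d) = env_const L c \<otimes>\<^bsub>env L\<^esub> env_const L d"
proof -
  have "Poly_Mapping.single (0::'a word) (c * d) = Poly_Mapping.single 0 c * Poly_Mapping.single 0 d"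
    by (simp add: mult_single)
  then show ?thesis
    by (simp add: env_const_proj proj_ops const_in_free_algebra)
qed

lemma env_const_one: "env_const L 1 = \<one>\<^bsub>env L\<^esub>"
  by (simp add: env_const_proj proj_one)

lemma env_const_central:
  assumes "r \<in> carrier (env L)"
  shows "env_const L c \<otimes>\<^bsub>env L\<^esub> r = r \<otimes>\<^bsub>env L\<^esub> env_const L c"
proof -
  obtain u where u: "u \<in> carrier (free_algebra (carrier L))" "r = proj u"
    using proj_surj[OF assms] .
  have "proj (Poly_Mapping.single 0 c * u) = proj (u * Poly_Mapping.single 0 c)"
    by (simp only: const_mult_commute)
  then show ?thesis
    by (simp add: env_const_proj proj_ops u const_in_free_algebra)
qed

lemma env_induct [consumes 1, case_names add const gen]:
  assumes "r \<in> carrier (env L)"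
    and add: "\<And>r s. r \<in> carrier (env L) \<Longrightarrow> s \<in> carrier (env L) \<Longrightarrow> P r \<Longrightarrow> P s \<Longrightarrow> P (r \<oplus>\<^bsub>env L\<^esub> s)"
    and const: "\<And>c. P (env_const L c)"
    and gen: "\<And>x r. x \<in> carrier L \<Longrightarrow> r \<in> carrier (env L) \<Longrightarrow> P r \<Longrightarrow> P (env_gen L x \<otimes>\<^bsub>env L\<^esub> r)"
  shows "P r"
proof -
  obtain u where u: "u \<in> carrier (free_algebra (carrier L))" "r = proj u"
    using proj_surj[OF assms(1)] .
  have "P (proj u)"
    using u(1)
  proof (induction u rule: free_algebra_induct)
    case zero
    then show ?case using const[of 0] by (simp add: env_const_proj)
  next
    case (add u v)
    then show ?case using assms(2) by (simp add: proj_ops proj_closed)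
  next
    case (const c)
    then show ?case using assms(3) by (simp add: env_const_proj)
  next
    case (letter x u)
    then show ?case using gen[of x "proj u"] by (simp add: proj_ops proj_closed env_gen_proj letter_in_free_algebra)
  qed
  then show ?thesis using u(2) by simp
qed

end

definition eval_character :: "('a \<Rightarrow> complex) \<Rightarrow> ('a word \<Rightarrow>\<^sub>0 complex) \<Rightarrow> complex" where
  "eval_character ev u =
    (\<Sum>w\<in>Poly_Mapping.keys u. Poly_Mapping.lookup u w * prod_list (map ev (letters w)))"

lemma eval_character_superset:
  assumes "finite S" "Poly_Mapping.keys u \<subseteq> S"
  shows "eval_character ev u = (\<Sum>w\<in>S. Poly_Mapping.lookup u w * prod_list (map ev (letters w)))"
  unfolding eval_character_def using assms
  by (intro sum.mono_neutral_left) (auto simp: in_keys_iff)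

lemma eval_character_add: "eval_character ev (u + v) = eval_character ev u + eval_character ev v"
proof -
  let ?S = "Poly_Mapping.keys u \<union> Poly_Mapping.keys v"
  have "Poly_Mapping.keys (u + v) \<subseteq> ?S" by (rule Poly_Mapping.keys_add)
  then show ?thesis
    by (simp add: eval_character_superset[of ?S] lookup_add distrib_right sum.distrib)
qed

lemma eval_character_single:
  "eval_character ev (Poly_Mapping.single w c) = c * prod_list (map ev (letters w))"
  by (simp add: eval_character_superset[of "{w}"])

lemma eval_character_zero: "eval_character ev 0 = 0"
  by (simp add: eval_character_def)

lemma eval_character_mult: "eval_character ev (u * v) = eval_character ev u * eval_character ev v"
proof (induction u rule: poly_mapping_add_induct)
  case (add w c u)
  have "eval_character ev (Poly_Mapping.single w c * v)
      = eval_character ev (Poly_Mapping.single w c) * eval_character ev v"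
    by (induction v rule: poly_mapping_add_induct)
      (simp_all add: eval_character_zero eval_character_add distrib_left mult_single
        eval_character_single plus_word_def)
  then show ?case
    by (simp add: distrib_right eval_character_add add.IH)
qed (simp add: eval_character_zero)

lemma eval_character_diff: "eval_character ev (u - v) = eval_character ev u - eval_character ev v"
  using eval_character_add[of ev "u - v" v] by simp

lemma eval_character_letter: "eval_character ev (letter x) = ev x"
  by (simp add: letter_def eval_character_single)

lemma (in lie_closed) eval_character_env_ideal:
  assumes ev: "\<And>x y. x \<in> carrier L \<Longrightarrow> y \<in> carrier L \<Longrightarrow> ev (lie_add L x y) = ev x + ev y"
    "\<And>c x. x \<in> carrier L \<Longrightarrow> ev (lie_scale L c x) = c * ev x"
    "\<And>x y. x \<in> carrier L \<Longrightarrow> y \<in> carrier L \<Longrightarrow> ev (lie_bracket L x y) = 0"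
    and "u \<in> env_ideal L"
  shows "eval_character ev u = 0"
proof -
  let ?I = "{u \<in> carrier (free_algebra (carrier L)). eval_character ev u = 0}"
  have "ideal ?I (free_algebra (carrier L))"
  proof (rule idealI[OF FA.ring_axioms])
    show "subgroup ?I (add_monoid (free_algebra (carrier L)))"
    proof (rule FA.add.subgroupI)
      have "0 \<in> ?I" by (simp add: free_algebra_simps eval_character_zero)
      then show "?I \<noteq> {}" by blast
    next
      fix u assume u: "u \<in> ?I"
      then have "\<ominus>\<^bsub>free_algebra (carrier L)\<^esub> u \<in> carrier (free_algebra (carrier L))" by simp
      then show "\<ominus>\<^bsub>free_algebra (carrier L)\<^esub> u \<in> ?I"
        using u eval_character_diff[of ev 0 u] by (simp add: free_algebra_uminus eval_character_zero)
    next
      fix u v assume "u \<in> ?I" "v \<in> ?I"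
      then show "u \<oplus>\<^bsub>free_algebra (carrier L)\<^esub> v \<in> ?I"
        by (simp add: free_algebra_simps(5) free_closed eval_character_add)
    qed auto
  qed (simp_all add: free_algebra_simps(2) free_closed eval_character_mult)
  moreover have "rels \<subseteq> ?I"
    using rels_closed ev
    by (auto simp: eval_character_diff eval_character_add eval_character_mult eval_character_letter
        eval_character_single zero_word_def subset_eq)
  ultimately have "env_ideal L \<subseteq> ?I"
    unfolding env_ideal_def by (rule FA.genideal_minimal)
  then show ?thesis using assms(4) by auto
qed

section \<open>Local nilpotency of the generators\<close>

context ring begin

lemma ad_closed: "f \<in> carrier R \<Longrightarrow> x \<in> carrier R \<Longrightarrow> ad R f x \<in> carrier R"
  by (simp add: ad_def)

lemma ad_pow_closed: "f \<in> carrier R \<Longrightarrow> x \<in> carrier R \<Longrightarrow> (ad R f ^^ n) x \<in> carrier R"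
  by (induction n) (simp_all add: ad_closed)

lemma ad_add:
  assumes "f \<in> carrier R" "x \<in> carrier R" "y \<in> carrier R"
  shows "ad R f (x \<oplus> y) = ad R f x \<oplus> ad R f y"
  using assms by (simp add: ad_def minus_eq l_distr r_distr minus_add) (simp add: a_ac)

lemma ad_pow_add:
  assumes "f \<in> carrier R" "x \<in> carrier R" "y \<in> carrier R"
  shows "(ad R f ^^ n) (x \<oplus> y) = (ad R f ^^ n) x \<oplus> (ad R f ^^ n) y"
  using assms by (induction n) (simp_all add: ad_add ad_pow_closed)

lemma ad_zero: "f \<in> carrier R \<Longrightarrow> ad R f \<zero> = \<zero>"
  by (simp add: ad_def minus_eq)

lemma ad_pow_zero: "f \<in> carrier R \<Longrightarrow> (ad R f ^^ n) \<zero> = \<zero>"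
  by (induction n) (simp_all add: ad_zero)

lemma ad_pow_mono:
  assumes "f \<in> carrier R" "(ad R f ^^ n) x = \<zero>" "n \<le> m"
  shows "(ad R f ^^ m) x = \<zero>"
proof -
  obtain k where "m = k + n" using \<open>n \<le> m\<close> by (metis add.commute le_Suc_ex)
  then show ?thesis using assms by (simp add: funpow_add ad_pow_zero)
qed

lemma ad_mult:
  assumes "f \<in> carrier R" "x \<in> carrier R" "y \<in> carrier R"
  shows "ad R f (x \<otimes> y) = ad R f x \<otimes> y \<oplus> x \<otimes> ad R f y"
proof -
  have "ad R f x \<otimes> y \<oplus> x \<otimes> ad R f y
      = f \<otimes> x \<otimes> y \<oplus> (\<ominus> (x \<otimes> f \<otimes> y) \<oplus> x \<otimes> f \<otimes> y) \<oplus> \<ominus> (x \<otimes> y \<otimes> f)"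
    using assms by (simp add: ad_def minus_eq l_distr r_distr l_minus r_minus m_assoc a_assoc)
  then show ?thesis
    using assms by (simp add: ad_def minus_eq m_assoc l_neg)
qed

lemma ad_pow_mult_zero:
  assumes f: "f \<in> carrier R"
  shows "\<lbrakk> x \<in> carrier R; y \<in> carrier R; (ad R f ^^ a) x = \<zero>; (ad R f ^^ b) y = \<zero>; a + b \<le> n \<rbrakk>
    \<Longrightarrow> (ad R f ^^ n) (x \<otimes> y) = \<zero>"
proof (induction n arbitrary: x y a b)
  case (Suc n)
  show ?case
  proof (cases "a = 0 \<or> b = 0")
    case True
    then have "x \<otimes> y = \<zero>" using Suc.prems by auto
    then show ?thesis by (simp only: ad_pow_zero[OF f])
  next
    case False
    then obtain a' b' where ab: "a = Suc a'" "b = Suc b'" by (meson not0_implies_Suc)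
    have "(ad R f ^^ n) (ad R f x \<otimes> y) = \<zero>"
      using Suc.prems f
      by (intro Suc.IH[where a = a' and b = b]) (simp_all add: ad_closed ab funpow_swap1)
    moreover have "(ad R f ^^ n) (x \<otimes> ad R f y) = \<zero>"
      using Suc.prems f
      by (intro Suc.IH[where a = a and b = b']) (simp_all add: ad_closed ab funpow_swap1)
    ultimately have "(ad R f ^^ n) (ad R f (x \<otimes> y)) = \<zero>"
      using Suc.prems f by (simp add: ad_mult ad_pow_add ad_closed)
    then show ?thesis by (simp add: funpow_swap1)
  qed
qed simp

lemma locally_nilpotent_mult:
  assumes "f \<in> carrier R" "x \<in> carrier R" "y \<in> carrier R"
    and "\<exists>n. (ad R f ^^ n) x = \<zero>" "\<exists>n. (ad R f ^^ n) y = \<zero>"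
  shows "\<exists>n. (ad R f ^^ n) (x \<otimes> y) = \<zero>"
  using assms ad_pow_mult_zero by blast

lemma locally_nilpotent_add:
  assumes "f \<in> carrier R" "x \<in> carrier R" "y \<in> carrier R"
    and "\<exists>n. (ad R f ^^ n) x = \<zero>" "\<exists>n. (ad R f ^^ n) y = \<zero>"
  shows "\<exists>n. (ad R f ^^ n) (x \<oplus> y) = \<zero>"
proof -
  obtain n k where n: "(ad R f ^^ n) x = \<zero>" "(ad R f ^^ k) y = \<zero>"
    using assms by blast
  then have "(ad R f ^^ max n k) (x \<oplus> y) = \<zero>"
    using assms(1-3) ad_pow_mono[OF assms(1) n(1), of "max n k"] ad_pow_mono[OF assms(1) n(2), of "max n k"]
    by (simp add: ad_pow_add)
  then show ?thesis by blast
qed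

lemma locally_nilpotent_uminus:
  assumes "f \<in> carrier R" "x \<in> carrier R" "\<exists>n. (ad R f ^^ n) x = \<zero>"
  shows "\<exists>n. (ad R f ^^ n) (\<ominus> x) = \<zero>"
proof -
  have "ad R f (\<ominus> \<one>) = \<zero>"
    using assms(1) by (simp add: ad_def minus_eq l_minus r_minus l_neg)
  then have "(ad R f ^^ 1) (\<ominus> \<one>) = \<zero>"
    by simp
  then have "\<exists>n. (ad R f ^^ n) (\<ominus> \<one> \<otimes> x) = \<zero>"
    using assms by (intro locally_nilpotent_mult) blast+
  then show ?thesis using assms(2) by (simp add: l_minus)
qed

end

lemma presented_lie_simps:
  "lie_add (presented_lie R) (lie_class R s) (lie_class R t) = lie_class R (LAdd s t)"
  "lie_scale (presented_lie R) c (lie_class R s) = lie_class R (LScale c s)"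
  "lie_bracket (presented_lie R) (lie_class R s) (lie_class R t) = lie_class R (LBr s t)"
  unfolding presented_lie_def lie_class_def
  by (auto intro: lie_eq.refl lie_eq.trans lie_eq.add_cong lie_eq.scale_cong lie_eq.br_cong)

lemma lie_class_eqI: "lie_eq R s t \<Longrightarrow> lie_class R s = lie_class R t"
  unfolding lie_class_def by (auto intro: lie_eq.trans lie_eq.sym)

lemma n_minus_simps:
  "carrier (n_minus A) = lie_span (kac_moody A) (range (km_f A))"
  "lie_add (n_minus A) = lie_add (presented_lie (kac_moody_rels A))"
  "lie_scale (n_minus A) = lie_scale (presented_lie (kac_moody_rels A))"
  "lie_bracket (n_minus A) = lie_bracket (presented_lie (kac_moody_rels A))"
  by (simp_all add: n_minus_def generated_lie_def kac_moody_def)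

lemma n_minus_lie_closed: "lie_closed (n_minus A)"
  by unfold_locales
    (simp_all add: n_minus_simps lie_span.intros flip: kac_moody_def)

lemma km_f_in_n_minus: "km_f A i \<in> carrier (n_minus A)"
  by (simp add: n_minus_simps lie_span.base)

context
  fixes A :: "'i \<Rightarrow> 'i \<Rightarrow> int"
begin

interpretation N: lie_closed "n_minus A"
  by (rule n_minus_lie_closed)

lemma bracket_pow_closed:
  assumes "x \<in> carrier (n_minus A)" "y \<in> carrier (n_minus A)"
  shows "(lie_bracket (n_minus A) x ^^ k) y \<in> carrier (n_minus A)"
  using assms by (induction k) (simp_all add: N.lie_bracket_closed)

lemma env_gen_bracket_pow:
  assumes "x \<in> carrier (n_minus A)" "y \<in> carrier (n_minus A)"
  shows "env_gen (n_minus A) ((lie_bracket (n_minus A) x ^^ k) y)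
    = (ad (env (n_minus A)) (env_gen (n_minus A) x) ^^ k) (env_gen (n_minus A) y)"
  using assms by (induction k) (simp_all add: N.env_gen_bracket bracket_pow_closed)

lemma serre_env:
  assumes "i \<noteq> j"
  shows "(ad (env (n_minus A)) (env_gen (n_minus A) (km_f A i)) ^^ nat (1 - A i j))
    (env_gen (n_minus A) (km_f A j)) = \<zero>\<^bsub>env (n_minus A)\<^esub>"
proof -
  let ?R = "kac_moody_rels A" and ?k = "nat (1 - A i j)"
  let ?Z = "lie_class ?R LZero"
  have pow: "(lie_bracket (n_minus A) (km_f A i) ^^ k) (km_f A j)
      = lie_class ?R ((LBr (LGen (F i)) ^^ k) (LGen (F j)))" for k
    by (induction k) (simp_all add: km_f_def n_minus_simps presented_lie_simps)
  have "((LBr (LGen (F i)) ^^ ?k) (LGen (F j)), LZero) \<in> ?R"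
    using assms unfolding kac_moody_rels_def by blast
  then have Z: "(lie_bracket (n_minus A) (km_f A i) ^^ ?k) (km_f A j) = ?Z"
    unfolding pow by (intro lie_class_eqI lie_eq.rel)
  have Zc: "?Z \<in> carrier (n_minus A)"
    unfolding Z[symmetric] by (intro bracket_pow_closed km_f_in_n_minus)
  have "lie_add (n_minus A) ?Z ?Z = ?Z"
    unfolding n_minus_simps presented_lie_simps by (intro lie_class_eqI lie_eq.add_zero)
  then have "env_gen (n_minus A) ?Z \<oplus>\<^bsub>env (n_minus A)\<^esub> env_gen (n_minus A) ?Z = env_gen (n_minus A) ?Z"
    using N.env_gen_add[OF Zc Zc] by simp
  then have "env_gen (n_minus A) ?Z = \<zero>\<^bsub>env (n_minus A)\<^esub>"
    using N.env_gen_closed[OF Zc] by (metis N.env.add.l_cancel_one)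
  then show ?thesis
    unfolding Z[symmetric] env_gen_bracket_pow[OF km_f_in_n_minus km_f_in_n_minus] .
qed

lemma ad_f_nilpotent_on_const:
  "\<exists>n. (ad (env (n_minus A)) (env_gen (n_minus A) (km_f A i)) ^^ n) (env_const (n_minus A) c)
    = \<zero>\<^bsub>env (n_minus A)\<^esub>"
proof
  show "(ad (env (n_minus A)) (env_gen (n_minus A) (km_f A i)) ^^ 1) (env_const (n_minus A) c)
    = \<zero>\<^bsub>env (n_minus A)\<^esub>"
    by (simp add: ad_def N.env_const_central N.env_const_closed N.env_gen_closed km_f_in_n_minus
        N.env.diff_eq_zero)
qed

lemma ad_f_nilpotent_on_gens:
  assumes "x \<in> carrier (n_minus A)"
  shows "\<exists>n. (ad (env (n_minus A)) (env_gen (n_minus A) (km_f A i)) ^^ n) (env_gen (n_minus A) x)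
    = \<zero>\<^bsub>env (n_minus A)\<^esub>"
proof -
  let ?f = "env_gen (n_minus A) (km_f A i)"
  have f: "?f \<in> carrier (env (n_minus A))"
    by (rule N.env_gen_closed[OF km_f_in_n_minus])
  note gen = N.env_gen_closed
  show ?thesis
    using assms unfolding n_minus_simps(1)
  proof (induction x rule: lie_span.induct)
    case (base x)
    then obtain j where j: "x = km_f A j" by blast
    show ?case
    proof (cases "i = j")
      case True
      then have "(ad (env (n_minus A)) ?f ^^ 1) (env_gen (n_minus A) x) = \<zero>\<^bsub>env (n_minus A)\<^esub>"
        using f by (simp add: ad_def j N.env.diff_eq_zero)
      then show ?thesis by blast
    next
      case False
      then show ?thesis unfolding j using serre_env by blast
    qed
  next
    case (add x y)
    then have xy: "x \<in> carrier (n_minus A)" "y \<in> carrier (n_minus A)"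
      by (simp_all add: n_minus_simps)
    have "lie_add (kac_moody A) x y = lie_add (n_minus A) x y"
      by (simp add: n_minus_simps kac_moody_def)
    then show ?case
      using N.env.locally_nilpotent_add[OF f gen[OF xy(1)] gen[OF xy(2)] add.IH]
      by (simp only: N.env_gen_add[OF xy])
  next
    case (scale x c)
    then have x: "x \<in> carrier (n_minus A)"
      by (simp add: n_minus_simps)
    have "lie_scale (kac_moody A) c x = lie_scale (n_minus A) c x"
      by (simp add: n_minus_simps kac_moody_def)
    then show ?case
      using N.env.locally_nilpotent_mult[OF f N.env_const_closed gen[OF x] ad_f_nilpotent_on_const scale.IH]
      by (simp only: N.env_gen_scale[OF x])
  next
    case (bracket x y)
    then have xy: "x \<in> carrier (n_minus A)" "y \<in> carrier (n_minus A)"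
      by (simp_all add: n_minus_simps)
    note xy' = gen[OF xy(1)] gen[OF xy(2)]
    have "lie_bracket (kac_moody A) x y = lie_bracket (n_minus A) x y"
      by (simp add: n_minus_simps kac_moody_def)
    moreover note N.env.locally_nilpotent_add[OF f _ _
        N.env.locally_nilpotent_mult[OF f xy' bracket.IH]
        N.env.locally_nilpotent_uminus[OF f _ N.env.locally_nilpotent_mult[OF f xy'(2,1) bracket.IH(2,1)]]]
    ultimately show ?case
      using xy' by (simp only: N.env_gen_bracket[OF xy] ad_def[of _ "env_gen _ x"] a_minus_def
          N.env.m_closed N.env.a_inv_closed)
  qed
qed

lemma ad_f_locally_nilpotent:
  assumes "r \<in> carrier (env (n_minus A))"
  shows "\<exists>n. (ad (env (n_minus A)) (env_gen (n_minus A) (km_f A i)) ^^ n) r = \<zero>\<^bsub>env (n_minus A)\<^esub>"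
  using assms
proof (induction r rule: N.env_induct)
  case (add r s)
  then show ?case
    by (intro N.env.locally_nilpotent_add N.env_gen_closed km_f_in_n_minus)
next
  case (const c)
  show ?case by (rule ad_f_nilpotent_on_const)
next
  case (gen x r)
  then show ?case
    by (intro N.env.locally_nilpotent_mult ad_f_nilpotent_on_gens N.env_gen_closed km_f_in_n_minus)
qed

end

section \<open>Complex powers under homomorphisms\<close>

lemma (in ring_hom_ring) hom_finsum_lessThan:
  assumes "\<And>i. t i \<in> carrier R"
  shows "h (finsum R t {..<n::nat}) = finsum S (\<lambda>i. h (t i)) {..<n}"
  using assms by (induction n) (simp_all add: R.finsum_lessThan_Suc S.finsum_lessThan_Suc R.finsum_closed)

lemma (in ring_hom_ring) hom_minus:
  assumes "x \<in> carrier R" "y \<in> carrier R"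
  shows "h (x \<ominus> y) = h x \<ominus>\<^bsub>S\<^esub> h y"
  using assms by (simp add: a_minus_def)

lemma (in ring_hom_ring) hom_ad:
  assumes "f \<in> carrier R" "x \<in> carrier R"
  shows "h ((ad R f ^^ n) x) = (ad S (h f) ^^ n) (h x)"
  using assms by (induction n) (simp_all add: ad_def[of R] ad_def[of S] hom_minus R.ad_pow_closed)

text \<open>
  The defining identity of \<open>f\<^sup>a W f\<^sup>b\<close> holds in the localization. Cleared of denominators it
  holds in the enveloping algebra, up to right multiplication by a power of \<open>f\<close>, and so its image
  holds in every ring in which \<open>f\<close> becomes invertible.
\<close>

lemma power_conj_image:
  assumes L: "lie_closed L"
    and ore: "ore_localization (env L) (powers (env L) f) Q \<iota>"
    and conj: "is_power_conj L Q \<iota> f a W b W'"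
    and s: "a + b = of_int s"
    and f: "f \<in> carrier (env L)" and W: "W \<in> carrier (env L)"
    and nil: "(ad (env L) f ^^ M) W = \<zero>\<^bsub>env L\<^esub>"
    and K: "ring K" and hom: "\<theta> \<in> ring_hom (env L) K"
    and unit: "\<theta> f \<in> Units K"
  shows "\<theta> W' = (\<Oplus>\<^bsub>K\<^esub>i\<in>{..<Suc M}. \<theta> (env_const L (a gchoose i))
    \<otimes>\<^bsub>K\<^esub> (ad K (\<theta> f) ^^ i) (\<theta> W) \<otimes>\<^bsub>K\<^esub> \<theta> f [^]\<^bsub>K\<^esub> (s - int i))"
proof -
  interpret lie_closed L by (rule L)
  interpret K: ring K by (rule K)
  interpret Q: ring Q using ore unfolding ore_localization_def by blast
  interpret \<theta>: ring_hom_ring "env L" K \<theta>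
    using hom by unfold_locales
  interpret \<iota>: ring_hom_ring "env L" Q \<iota>
    using ore unfolding ore_localization_def by unfold_locales blast
  let ?R = "env L"
  let ?D = "\<lambda>i. (ad ?R f ^^ i) W"
  let ?c = "\<lambda>i. env_const L (a gchoose i)"
  let ?t = "\<lambda>i. \<iota> (?c i \<otimes>\<^bsub>?R\<^esub> ?D i) \<otimes>\<^bsub>Q\<^esub> \<iota> f [^]\<^bsub>Q\<^esub> (s - int i)"
  have "f = f [^]\<^bsub>?R\<^esub> (1::nat)" using f by simp
  then have "f \<in> powers ?R f" unfolding powers_def by blast
  then have g: "\<iota> f \<in> Units Q"
    using ore unfolding ore_localization_def by blast
  have ker: "\<exists>k::nat. r \<otimes>\<^bsub>?R\<^esub> f [^]\<^bsub>?R\<^esub> k = \<zero>\<^bsub>?R\<^esub>" if "r \<in> carrier ?R" "\<iota> r = \<zero>\<^bsub>Q\<^esub>" for r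
    using ore that unfolding ore_localization_def powers_def by blast
  have W': "W' \<in> carrier ?R"
    using conj unfolding is_power_conj_def by blast
  obtain s' :: int where "a + b = of_int s'"
    and sum: "\<iota> W' = (\<Oplus>\<^bsub>Q\<^esub>i\<in>{i. ?D i \<noteq> \<zero>\<^bsub>?R\<^esub>}. \<iota> (?c i \<otimes>\<^bsub>?R\<^esub> ?D i) \<otimes>\<^bsub>Q\<^esub> \<iota> f [^]\<^bsub>Q\<^esub> (s' - int i))"
    using conj unfolding is_power_conj_def by blast
  then have s': "s' = s" using s by simp
  have D: "?D i \<in> carrier ?R" for i
    by (rule env.ad_pow_closed[OF f W])
  have cD: "?c i \<otimes>\<^bsub>?R\<^esub> ?D i \<in> carrier ?R" for i
    by (intro env.m_closed env_const_closed D)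
  have t: "?t i \<in> carrier Q" for i
    using g cD by (intro Q.m_closed Q.int_pow_Units_closed \<iota>.hom_closed)
  have D0: "?D i = \<zero>\<^bsub>?R\<^esub>" if "i \<ge> M" for i
    by (rule env.ad_pow_mono[OF f nil that])
  have "\<iota> W' = finsum Q ?t {i. ?D i \<noteq> \<zero>\<^bsub>?R\<^esub>}"
    using sum s' by simp
  also have "\<dots> = finsum Q ?t {..<Suc M}"
  proof (rule Q.add.finprod_mono_neutral_cong_left)
    show "{i. ?D i \<noteq> \<zero>\<^bsub>?R\<^esub>} \<subseteq> {..<Suc M}"
    proof
      fix i assume "i \<in> {i. ?D i \<noteq> \<zero>\<^bsub>?R\<^esub>}"
      then show "i \<in> {..<Suc M}" using D0[of i] by (cases "M \<le> i") simp_all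
    qed
    show "?t i = \<zero>\<^bsub>Q\<^esub>" if "i \<in> {..<Suc M} - {i. ?D i \<noteq> \<zero>\<^bsub>?R\<^esub>}" for i
    proof -
      have "?D i = \<zero>\<^bsub>?R\<^esub>" using that by blast
      then show ?thesis using g by (simp add: env_const_closed)
    qed
    show "?t \<in> {..<Suc M} \<rightarrow> carrier Q" using t by (rule Pi_I)
  qed (rule finite_lessThan, rule HOL.refl)
  finally have sum': "\<iota> W' = finsum Q ?t {..<Suc M}" .
  define N where "N = nat \<bar>s\<bar> + Suc M"
  define e where "e i = nat (s - int i + int N)" for i
  have e: "int (e i) = s - int i + int N" if "i < Suc M" for i
  proof -
    have "0 \<le> s - int i + int N" using that unfolding N_def by linarith
    then show ?thesis by (simp add: e_def)
  qed
  let ?u = "\<lambda>i. ?c i \<otimes>\<^bsub>?R\<^esub> ?D i \<otimes>\<^bsub>?R\<^esub> f [^]\<^bsub>?R\<^esub> e i"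
  have u: "?u i \<in> carrier ?R" for i
    by (rule env.m_closed[OF cD env.nat_pow_closed[OF f]])
  let ?Y = "finsum ?R ?u {..<Suc M}"
  have Y: "?Y \<in> carrier ?R"
    by (rule env.finsum_closed) (use u in blast)
  have "\<iota> (W' \<otimes>\<^bsub>?R\<^esub> f [^]\<^bsub>?R\<^esub> N) = finsum Q ?t {..<Suc M} \<otimes>\<^bsub>Q\<^esub> \<iota> f [^]\<^bsub>Q\<^esub> N"
    using f W' by (simp add: sum'[symmetric] \<iota>.hom_nat_pow)
  also have "\<dots> = (\<Oplus>\<^bsub>Q\<^esub>i\<in>{..<Suc M}. ?t i \<otimes>\<^bsub>Q\<^esub> \<iota> f [^]\<^bsub>Q\<^esub> N)"
    by (rule Q.finsum_ldistr[OF finite_lessThan _ Pi_I[OF t]]) (simp add: f)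
  also have "\<dots> = (\<Oplus>\<^bsub>Q\<^esub>i\<in>{..<Suc M}. \<iota> (?u i))"
  proof (rule Q.finsum_cong')
    fix i assume i: "i \<in> {..<Suc M}"
    have "\<iota> f [^]\<^bsub>Q\<^esub> (s - int i) \<otimes>\<^bsub>Q\<^esub> \<iota> f [^]\<^bsub>Q\<^esub> N = \<iota> f [^]\<^bsub>Q\<^esub> e i"
      using i by (simp only: int_pow_int[symmetric] e lessThan_iff Q.int_pow_Units_add[OF g])
    then show "?t i \<otimes>\<^bsub>Q\<^esub> \<iota> f [^]\<^bsub>Q\<^esub> N = \<iota> (?u i)"
      using f g cD[of i] by (simp add: Q.m_assoc \<iota>.hom_nat_pow del: \<iota>.hom_mult)
        (simp add: \<iota>.hom_nat_pow)
  qed (use u in simp_all)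
  also have "\<dots> = \<iota> ?Y"
    using u by (simp only: \<iota>.hom_finsum_lessThan)
  finally have "\<iota> (W' \<otimes>\<^bsub>?R\<^esub> f [^]\<^bsub>?R\<^esub> N \<ominus>\<^bsub>?R\<^esub> ?Y) = \<zero>\<^bsub>Q\<^esub>"
    using W' f Y by (simp add: \<iota>.hom_minus Q.diff_eq_zero)
  then obtain k :: nat where k: "(W' \<otimes>\<^bsub>?R\<^esub> f [^]\<^bsub>?R\<^esub> N \<ominus>\<^bsub>?R\<^esub> ?Y) \<otimes>\<^bsub>?R\<^esub> f [^]\<^bsub>?R\<^esub> k = \<zero>\<^bsub>?R\<^esub>"
    using ker[of "W' \<otimes>\<^bsub>?R\<^esub> f [^]\<^bsub>?R\<^esub> N \<ominus>\<^bsub>?R\<^esub> ?Y"] W' f Y by blast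
  let ?F = "\<theta> f"
  let ?v = "\<lambda>i. \<theta> (?c i) \<otimes>\<^bsub>K\<^esub> (ad K ?F ^^ i) (\<theta> W) \<otimes>\<^bsub>K\<^esub> ?F [^]\<^bsub>K\<^esub> (s - int i)"
  have v: "?v i \<in> carrier K" for i
    using unit f W by (intro K.m_closed K.ad_pow_closed K.int_pow_Units_closed \<theta>.hom_closed env_const_closed)
  have "(\<theta> W' \<otimes>\<^bsub>K\<^esub> ?F [^]\<^bsub>K\<^esub> N \<ominus>\<^bsub>K\<^esub> \<theta> ?Y) \<otimes>\<^bsub>K\<^esub> ?F [^]\<^bsub>K\<^esub> k = \<zero>\<^bsub>K\<^esub> \<otimes>\<^bsub>K\<^esub> ?F [^]\<^bsub>K\<^esub> k"
    using arg_cong[OF k, of \<theta>] W' f Y by (simp add: \<theta>.hom_minus \<theta>.hom_nat_pow)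
  then have "\<theta> W' \<otimes>\<^bsub>K\<^esub> ?F [^]\<^bsub>K\<^esub> N \<ominus>\<^bsub>K\<^esub> \<theta> ?Y = \<zero>\<^bsub>K\<^esub>"
    by (rule K.Units_r_cancel[OF K.nat_pow_Units[OF unit] _ K.zero_closed, rotated])
      (use W' f Y in simp)
  then have "\<theta> W' \<otimes>\<^bsub>K\<^esub> ?F [^]\<^bsub>K\<^esub> N = \<theta> ?Y"
    using W' f Y by (simp add: K.diff_eq_zero)
  also have "\<dots> = (\<Oplus>\<^bsub>K\<^esub>i\<in>{..<Suc M}. \<theta> (?u i))"
    using u by (simp only: \<theta>.hom_finsum_lessThan)
  also have "\<dots> = (\<Oplus>\<^bsub>K\<^esub>i\<in>{..<Suc M}. \<theta> (?c i) \<otimes>\<^bsub>K\<^esub> (ad K ?F ^^ i) (\<theta> W)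
      \<otimes>\<^bsub>K\<^esub> ?F [^]\<^bsub>K\<^esub> (s - int i) \<otimes>\<^bsub>K\<^esub> ?F [^]\<^bsub>K\<^esub> N)"
  proof (rule K.finsum_cong')
    fix i assume i: "i \<in> {..<Suc M}"
    have "?F [^]\<^bsub>K\<^esub> (s - int i) \<otimes>\<^bsub>K\<^esub> ?F [^]\<^bsub>K\<^esub> N = ?F [^]\<^bsub>K\<^esub> e i"
      using i by (simp only: int_pow_int[symmetric] e lessThan_iff K.int_pow_Units_add[OF unit])
    then show "\<theta> (?u i) = \<theta> (?c i) \<otimes>\<^bsub>K\<^esub> (ad K ?F ^^ i) (\<theta> W)
      \<otimes>\<^bsub>K\<^esub> ?F [^]\<^bsub>K\<^esub> (s - int i) \<otimes>\<^bsub>K\<^esub> ?F [^]\<^bsub>K\<^esub> N"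
      using f W unit D env_const_closed
      by (simp add: K.m_assoc \<theta>.hom_nat_pow \<theta>.hom_ad K.ad_pow_closed)
  qed (rule HOL.refl, rule Pi_I, rule K.m_closed[OF v], simp add: f)
  also have "\<dots> = finsum K ?v {..<Suc M} \<otimes>\<^bsub>K\<^esub> ?F [^]\<^bsub>K\<^esub> N"
    by (rule K.finsum_ldistr[symmetric, OF finite_lessThan _ Pi_I[OF v]]) (simp add: f)
  finally have "\<theta> W' \<otimes>\<^bsub>K\<^esub> ?F [^]\<^bsub>K\<^esub> N = finsum K ?v {..<Suc M} \<otimes>\<^bsub>K\<^esub> ?F [^]\<^bsub>K\<^esub> N" .
  moreover have "finsum K ?v {..<Suc M} \<in> carrier K"
    by (rule K.finsum_closed) (use v in blast)
  ultimately show ?thesis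
    using K.Units_r_cancel[OF K.nat_pow_Units[OF unit, of N] \<theta>.hom_closed[OF W']] by blast
qed

section \<open>The Heisenberg enveloping algebra\<close>

lemma heisenberg_simps:
  "carrier heisenberg = UNIV"
  "lie_add heisenberg (a, b, c) (a', b', c') = (a + a', b + b', c + c')"
  "lie_scale heisenberg t (a, b, c) = (t * a, t * b, t * c)"
  "lie_bracket heisenberg (a, b, c) (a', b', c') = (0, 0, a * b' - b * a')"
  by (simp_all add: heisenberg_def)

interpretation heis: lie_closed heisenberg
  by unfold_locales (simp_all add: heisenberg_simps)

lemma U_H_f_closed: "U_H_f i \<in> carrier U_H"
  unfolding U_H_f_def by (rule heis.env_gen_closed) (simp add: heisenberg_simps)

lemma U_H_h_closed: "U_H_h \<in> carrier U_H"
  unfolding U_H_h_def by (rule heis.env_gen_closed) (simp add: heisenberg_simps)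

lemma U_H_h_bracket: "ad U_H (U_H_f N1) (U_H_f N2) = U_H_h"
  using heis.env_gen_bracket[of "heis_f N1" "heis_f N2"]
  by (simp add: U_H_f_def U_H_h_def heisenberg_simps heis_h_def)

lemma U_H_comm: "U_H_f N1 \<otimes>\<^bsub>U_H\<^esub> U_H_f N2 = U_H_f N2 \<otimes>\<^bsub>U_H\<^esub> U_H_f N1 \<oplus>\<^bsub>U_H\<^esub> U_H_h"
  unfolding U_H_h_bracket[symmetric] ad_def
  using U_H_f_closed by (simp add: a_minus_def heis.env.a_lcomm heis.env.r_neg)

lemma U_H_h_central: "U_H_f i \<otimes>\<^bsub>U_H\<^esub> U_H_h = U_H_h \<otimes>\<^bsub>U_H\<^esub> U_H_f i"
proof -
  let ?z = "env_gen heisenberg (0, 0, 0)"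
  have z: "?z \<in> carrier U_H"
    by (rule heis.env_gen_closed) (simp add: heisenberg_simps)
  have "?z \<oplus>\<^bsub>U_H\<^esub> ?z = ?z"
    using heis.env_gen_add[of "(0, 0, 0)" "(0, 0, 0)"] by (simp add: heisenberg_simps)
  then have "?z = \<zero>\<^bsub>U_H\<^esub>"
    using z by (metis heis.env.add.l_cancel_one)
  moreover have "ad U_H (U_H_f i) U_H_h = ?z"
    using heis.env_gen_bracket[of "heis_f i" heis_h]
    by (cases i) (simp_all add: U_H_f_def U_H_h_def heisenberg_simps heis_h_def)
  ultimately show ?thesis
    using U_H_f_closed U_H_h_closed by (simp add: ad_def heis.env.diff_eq_zero)
qed

text \<open>The character of \<open>U(\<H>)\<close> with \<open>f\<^sub>1, f\<^sub>2 \<mapsto> 1\<close> and \<open>h \<mapsto> 0\<close> detects that \<open>f\<^sub>i\<close> and \<open>H\<^sub>u\<close> are nonzero.\<close>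

lemma heis_proj_nonzero:
  assumes u: "u \<in> carrier (free_algebra (carrier heisenberg))"
    and "eval_character (\<lambda>(a, b, c). a + b) u \<noteq> 0"
  shows "heis.proj u \<noteq> \<zero>\<^bsub>U_H\<^esub>"
proof
  assume "heis.proj u = \<zero>\<^bsub>U_H\<^esub>"
  then have "heis.proj u = heis.proj 0" by (simp add: heis.proj_zero)
  then have "u \<in> env_ideal heisenberg"
    using heis.proj_eq_iff[OF u, of 0] by (simp add: free_algebra_simps)
  then have "eval_character (\<lambda>(a, b, c). a + b) u = 0"
    by (intro heis.eval_character_env_ideal) (auto simp: heisenberg_simps algebra_simps)
  then show False using assms(2) by simp
qed

lemma U_H_f_nonzero: "U_H_f i \<noteq> \<zero>\<^bsub>U_H\<^esub>"
  unfolding U_H_f_def heis.env_gen_proj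
  by (rule heis_proj_nonzero, rule letter_in_free_algebra)
    (cases i; simp add: heisenberg_simps eval_character_letter)+

lemma H_elem_closed: "H_elem u \<in> carrier U_H"
  unfolding H_elem_def
  by (intro heis.env.a_closed heis.env.m_closed U_H_f_closed U_H_h_closed heis.env_const_closed)

lemma H_elem_nonzero: "H_elem u \<noteq> \<zero>\<^bsub>U_H\<^esub>"
proof -
  have l: "letter x \<in> carrier (free_algebra (carrier heisenberg))" for x
    by (rule letter_in_free_algebra) (simp add: heisenberg_simps)
  let ?u = "letter (heis_f N2) * letter (heis_f N1) + Poly_Mapping.single 0 u * letter heis_h"
  note closed = heis.free_closed(3)[OF l l] heis.free_closed(3)[OF const_in_free_algebra l]
  have "H_elem u = heis.proj ?u"
    by (simp add: H_elem_def U_H_f_def U_H_h_def heis.env_gen_proj heis.env_const_proj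
        heis.proj_ops closed l const_in_free_algebra)
  moreover have "heis.proj ?u \<noteq> \<zero>\<^bsub>U_H\<^esub>"
    by (rule heis_proj_nonzero, rule heis.free_closed(1)[OF closed])
      (simp add: eval_character_add eval_character_mult eval_character_letter eval_character_single
        zero_word_def heis_h_def)
  ultimately show ?thesis by simp
qed

lemma skew_field_heisenberg_ring:
  assumes "skew_field_of_fractions U_H K \<kappa>"
  shows "heisenberg_ring K (\<lambda>c. \<kappa> (env_const heisenberg c)) (\<lambda>i. \<kappa> (U_H_f i)) (\<kappa> U_H_h)"
    and "\<kappa> \<in> ring_hom U_H K"
    and "\<kappa> (H_elem u) = \<kappa> (U_H_f N2) \<otimes>\<^bsub>K\<^esub> \<kappa> (U_H_f N1)
      \<oplus>\<^bsub>K\<^esub> \<kappa> (env_const heisenberg u) \<otimes>\<^bsub>K\<^esub> \<kappa> U_H_h"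
proof -
  interpret K: ring K
    using assms unfolding skew_field_of_fractions_def ore_localization_def by blast
  show hom: "\<kappa> \<in> ring_hom U_H K"
    using assms unfolding skew_field_of_fractions_def ore_localization_def by blast
  interpret \<kappa>: ring_hom_ring U_H K \<kappa>
    using hom by unfold_locales
  have units: "\<kappa> s \<in> Units K" if "s \<in> carrier U_H" "s \<noteq> \<zero>\<^bsub>U_H\<^esub>" for s
    using assms that unfolding skew_field_of_fractions_def ore_localization_def by blast
  have fractions: "\<exists>r\<in>carrier U_H. \<exists>s\<in>carrier U_H - {\<zero>\<^bsub>U_H\<^esub>}. x = \<kappa> r \<otimes>\<^bsub>K\<^esub> inv\<^bsub>K\<^esub> (\<kappa> s)"
    if "x \<in> carrier K" for x
    using assms that unfolding skew_field_of_fractions_def ore_localization_def by blast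
  show H: "\<kappa> (H_elem u) = \<kappa> (U_H_f N2) \<otimes>\<^bsub>K\<^esub> \<kappa> (U_H_f N1)
      \<oplus>\<^bsub>K\<^esub> \<kappa> (env_const heisenberg u) \<otimes>\<^bsub>K\<^esub> \<kappa> U_H_h" for u
    by (simp add: H_elem_def U_H_f_closed U_H_h_closed heis.env_const_closed)
  show "heisenberg_ring K (\<lambda>c. \<kappa> (env_const heisenberg c)) (\<lambda>i. \<kappa> (U_H_f i)) (\<kappa> U_H_h)"
  proof unfold_locales
    fix c d :: complex
    show "\<kappa> (env_const heisenberg c) \<in> carrier K"
      by (simp add: heis.env_const_closed)
    show "\<kappa> (env_const heisenberg (c + d)) = \<kappa> (env_const heisenberg c) \<oplus>\<^bsub>K\<^esub> \<kappa> (env_const heisenberg d)"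
      by (simp add: heis.env_const_add heis.env_const_closed)
    show "\<kappa> (env_const heisenberg (c * d)) = \<kappa> (env_const heisenberg c) \<otimes>\<^bsub>K\<^esub> \<kappa> (env_const heisenberg d)"
      by (simp add: heis.env_const_mult heis.env_const_closed)
  next
    show "\<kappa> (env_const heisenberg 1) = \<one>\<^bsub>K\<^esub>"
      by (simp add: heis.env_const_one)
  next
    fix x c assume "x \<in> carrier K"
    then obtain r s where rs: "r \<in> carrier U_H" "s \<in> carrier U_H" "s \<noteq> \<zero>\<^bsub>U_H\<^esub>"
      and x: "x = \<kappa> r \<otimes>\<^bsub>K\<^esub> inv\<^bsub>K\<^esub> (\<kappa> s)"
      using fractions by blast
    let ?c = "\<kappa> (env_const heisenberg c)"
    have comm: "\<kappa> t \<otimes>\<^bsub>K\<^esub> ?c = ?c \<otimes>\<^bsub>K\<^esub> \<kappa> t" if "t \<in> carrier U_H" for t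
      using that heis.env_const_central[OF that, of c] heis.env_const_closed
      by (metis \<kappa>.hom_mult)
    have cc: "?c \<in> carrier K" by (simp add: heis.env_const_closed)
    have u: "\<kappa> s \<in> Units K" by (rule units[OF rs(2,3)])
    have "x \<otimes>\<^bsub>K\<^esub> ?c = \<kappa> r \<otimes>\<^bsub>K\<^esub> (inv\<^bsub>K\<^esub> (\<kappa> s) \<otimes>\<^bsub>K\<^esub> ?c)"
      using u rs cc by (simp add: x K.m_assoc)
    also have "\<dots> = (\<kappa> r \<otimes>\<^bsub>K\<^esub> ?c) \<otimes>\<^bsub>K\<^esub> inv\<^bsub>K\<^esub> (\<kappa> s)"
      unfolding K.commute_inv[OF u cc comm[OF rs(2)]] using u rs cc by (simp add: K.m_assoc)
    also have "\<dots> = ?c \<otimes>\<^bsub>K\<^esub> x"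
      unfolding comm[OF rs(1)] using u rs cc by (simp add: x K.m_assoc)
    finally show "x \<otimes>\<^bsub>K\<^esub> ?c = ?c \<otimes>\<^bsub>K\<^esub> x" .
  next
    fix i
    show "\<kappa> (U_H_f i) \<in> Units K"
      by (rule units[OF U_H_f_closed U_H_f_nonzero])
    show "\<kappa> (U_H_f i) \<otimes>\<^bsub>K\<^esub> \<kappa> U_H_h = \<kappa> U_H_h \<otimes>\<^bsub>K\<^esub> \<kappa> (U_H_f i)"
      using \<kappa>.hom_mult U_H_h_central U_H_f_closed U_H_h_closed by metis
  next
    show "\<kappa> U_H_h \<in> carrier K" by (simp add: U_H_h_closed)
    have "\<kappa> (U_H_f N1 \<otimes>\<^bsub>U_H\<^esub> U_H_f N2) = \<kappa> (U_H_f N2 \<otimes>\<^bsub>U_H\<^esub> U_H_f N1 \<oplus>\<^bsub>U_H\<^esub> U_H_h)"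
      by (simp only: U_H_comm)
    then show "\<kappa> (U_H_f N1) \<otimes>\<^bsub>K\<^esub> \<kappa> (U_H_f N2) = \<kappa> (U_H_f N2) \<otimes>\<^bsub>K\<^esub> \<kappa> (U_H_f N1) \<oplus>\<^bsub>K\<^esub> \<kappa> U_H_h"
      by (simp add: U_H_f_closed U_H_h_closed)
  next
    fix u
    show "\<kappa> (U_H_f N2) \<otimes>\<^bsub>K\<^esub> \<kappa> (U_H_f N1)
      \<oplus>\<^bsub>K\<^esub> \<kappa> (env_const heisenberg u) \<otimes>\<^bsub>K\<^esub> \<kappa> U_H_h \<in> Units K"
      unfolding H[symmetric] by (rule units[OF H_elem_closed H_elem_nonzero])
  qed
qed

section \<open>The singular words\<close>

lemma Gamma1_odd: "Gamma1 p q (2 * l + 1) = Gamma2 p q (2 * l + 2)"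
  by (simp add: Gamma1_def Gamma2_def lessThan_Suc_atMost)

lemma Gamma_initial:
  "Gamma1 p q 0 = 0" "Gamma1 p q 1 = 1" "Gamma2 p q 1 = 0" "Gamma2 p q 2 = 1"
  by (simp_all add: Gamma1_def Gamma2_def)

lemma Gamma1_odd': "odd k \<Longrightarrow> Gamma1 p q k = Gamma2 p q (Suc k)"
  by (elim oddE) (simp only: Gamma1_odd Suc_eq_plus1 add.assoc one_add_one)

definition V_node :: "nat \<Rightarrow> node" where
  "V_node k = (if even k then N1 else N2)"

lemma V_node_Suc: "V_node (Suc k) = opp (V_node k)"
  by (simp add: V_node_def)

lemma sg_V_node: "sg (V_node k) = (-1) ^ k" "sg (opp (V_node k)) = - ((-1) ^ k)"
  by (simp_all add: V_node_def)

definition V_exp :: "nat \<Rightarrow> nat \<Rightarrow> nat \<Rightarrow> complex \<Rightarrow> nat \<Rightarrow> complex" where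
  "V_exp p q m \<alpha> k = of_int (Gamma2 p q (k + 1)) * \<alpha> - of_int (Gamma1 p q (k - 1)) * of_nat m"

definition V_tilde_exp :: "nat \<Rightarrow> nat \<Rightarrow> nat \<Rightarrow> complex \<Rightarrow> nat \<Rightarrow> complex" where
  "V_tilde_exp p q m \<alpha> k = of_int (Gamma1 p q k) * \<alpha> - of_int (Gamma2 p q k) * of_nat m"

lemma is_V_step:
  assumes "is_V p q Q \<iota> m \<alpha> V" "k \<ge> 1"
  shows "\<exists>b. is_f_power_conj p q Q \<iota> (V_node k) (V_exp p q m \<alpha> k) (V k) b (V (Suc k))
    \<and> V_exp p q m \<alpha> k + b = of_int ((Gamma1 p q (k + 1) - Gamma1 p q (k - 1)) * int m)"
proof (cases "odd k")
  case True
  then obtain j where j: "k = 2 * j + 1" by (elim oddE)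
  define l where "l = Suc j"
  have l: "l \<ge> 1" "k = 2 * l - 1" "Suc k = 2 * l" "k - 1 = 2 * l - 2"
    using j by (simp_all add: l_def)
  let ?b = "- of_int (Gamma1 p q k) * \<alpha> + of_int (Gamma1 p q (Suc k)) * of_nat m"
  have "V_exp p q m \<alpha> k = of_int (Gamma1 p q k) * \<alpha> - of_int (Gamma1 p q (k - 1)) * of_nat m"
    using Gamma1_odd'[OF True] by (simp add: V_exp_def)
  then have "is_f_power_conj p q Q \<iota> (V_node k) (V_exp p q m \<alpha> k) (V k) ?b (V (Suc k))"
    using assms(1) True l unfolding is_V_def Let_def by (simp add: V_node_def)
  then show ?thesis
    using Gamma1_odd'[OF True] by (intro exI[of _ ?b]) (simp add: V_exp_def algebra_simps)
next
  case False
  then obtain l where "k = 2 * l" by (auto elim: evenE)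
  then have l: "l \<ge> 1" "k = 2 * l" using assms(2) by simp_all
  let ?b = "- of_int (Gamma2 p q (Suc k)) * \<alpha> + of_int (Gamma2 p q (Suc (Suc k))) * of_nat m"
  have g: "Gamma1 p q (k - 1) = Gamma2 p q k" "Gamma1 p q (Suc k) = Gamma2 p q (Suc (Suc k))"
    using Gamma1_odd'[of "k - 1" p q] Gamma1_odd'[of "k + 1" p q] False assms(2) by simp_all
  have "is_f_power_conj p q Q \<iota> (V_node k) (V_exp p q m \<alpha> k) (V k) ?b (V (Suc k))"
    using assms(1) False l g unfolding is_V_def Let_def by (simp add: V_node_def V_exp_def)
  then show ?thesis
    by (intro exI[of _ ?b]) (simp add: V_exp_def g algebra_simps)
qed

lemma is_V_tilde_step:
  assumes "is_V_tilde p q Q \<iota> m \<alpha> V" "k \<ge> 1"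
  shows "\<exists>b. is_f_power_conj p q Q \<iota> (opp (V_node k)) (V_tilde_exp p q m \<alpha> k) (V k) b (V (Suc k))
    \<and> V_tilde_exp p q m \<alpha> k + b = of_int ((Gamma2 p q (k + 2) - Gamma2 p q k) * int m)"
proof (cases "odd k")
  case True
  then obtain j where j: "k = 2 * j + 1" by (elim oddE)
  define l where "l = Suc j"
  have l: "l \<ge> 1" "k = 2 * l - 1" "Suc k = 2 * l" "Suc (Suc k) = 2 * l + 1"
    using j by (simp_all add: l_def)
  let ?b = "- of_int (Gamma2 p q (Suc k)) * \<alpha> + of_int (Gamma2 p q (Suc (Suc k))) * of_nat m"
  have g: "V_tilde_exp p q m \<alpha> k = of_int (Gamma2 p q (Suc k)) * \<alpha> - of_int (Gamma2 p q k) * of_nat m"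
    using Gamma1_odd'[OF True] by (simp add: V_tilde_exp_def)
  then have "is_f_power_conj p q Q \<iota> (opp (V_node k)) (V_tilde_exp p q m \<alpha> k) (V k) ?b (V (Suc k))"
    using assms(1) True l unfolding is_V_tilde_def Let_def by (simp add: V_node_def)
  then show ?thesis
    unfolding g by (intro exI[of _ ?b]) (simp add: algebra_simps)
next
  case False
  then obtain l where "k = 2 * l" by (auto elim: evenE)
  then have l: "l \<ge> 1" "k = 2 * l" using assms(2) by simp_all
  let ?b = "- of_int (Gamma1 p q k) * \<alpha> + of_int (Gamma1 p q (Suc k)) * of_nat m"
  have g: "Gamma1 p q (k - 1) = Gamma2 p q k" "Gamma1 p q (Suc k) = Gamma2 p q (Suc (Suc k))"
    using Gamma1_odd'[of "k - 1" p q] Gamma1_odd'[of "k + 1" p q] False assms(2) by simp_all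
  have "is_f_power_conj p q Q \<iota> (opp (V_node k)) (V_tilde_exp p q m \<alpha> k) (V k) ?b (V (Suc k))"
    using assms(1) False l unfolding is_V_tilde_def Let_def V_tilde_exp_def g(1)[symmetric]
    by (simp add: V_node_def)
  then show ?thesis
    using g(2) by (intro exI[of _ ?b]) (simp add: V_tilde_exp_def algebra_simps)
qed

lemma alt_sum_ivl: "alt_sum g lo (int hi - 1) = (\<Sum>i=lo..<hi. (-1) ^ i * g i)"
  unfolding alt_sum_def by (rule sum.cong) auto

lemma alt_sum_Suc:
  assumes "g lo = 0"
  shows "alt_sum g (Suc lo) hi = alt_sum g lo hi"
  unfolding alt_sum_def
proof (rule sum.mono_neutral_left)
  have "{i. lo \<le> i \<and> int i \<le> hi} \<subseteq> {..nat hi}" by auto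
  then show "finite {i. lo \<le> i \<and> int i \<le> hi}" by (rule finite_subset) simp
  show "\<forall>i\<in>{i. lo \<le> i \<and> int i \<le> hi} - {i. Suc lo \<le> i \<and> int i \<le> hi}. (-1) ^ i * g i = 0"
    using assms by (auto simp: Suc_le_eq order_le_less)
qed auto

lemma H_prod_uniform:
  assumes "w \<ge> 1"
  shows "H_prod p q m \<alpha> K \<kappa> r s w = upto_prod K ((Gamma1 p q w - Gamma1 p q (w - 1)) * int m)
    (\<lambda>j. \<kappa> (H_elem (of_int (- alt_sum (Gamma2 p q) (w + 1) r) * \<alpha>
      + of_int (alt_sum (Gamma1 p q) (w - 1) s * int m + offset (V_node w) j))))"
proof -
  consider "w = 1" | "w \<noteq> 1" "even w" | "w \<noteq> 1" "odd w" by blast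
  then show ?thesis
  proof cases
    case 1
    then show ?thesis
      using alt_sum_Suc[of "Gamma1 p q" 0 s]
      by (simp add: H_prod_def Let_def V_node_def Gamma_initial[unfolded One_nat_def] numeral_2_eq_2[symmetric])
  next
    case 2
    then obtain l where w: "w = 2 * l" "l \<ge> 1" using assms by (elim evenE) auto
    have "Gamma1 p q (w - 1) = Gamma2 p q w"
      using Gamma1_odd'[of "w - 1" p q] 2 assms by simp
    then show ?thesis
      using 2 w by (simp add: H_prod_def Let_def V_node_def algebra_simps)
  next
    case 3
    then obtain l where w: "w = 2 * l + 1" "l \<ge> 1" using assms by (elim oddE) auto
    show ?thesis
      using 3 w Gamma1_odd[of p q l] by (simp add: H_prod_def Let_def V_node_def)
  qed
qed

lemma H_prod_tilde_uniform:
  assumes "w \<ge> 1"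
  shows "H_prod_tilde p q m \<alpha> K \<kappa> r s w = upto_prod K ((Gamma2 p q (w + 1) - Gamma2 p q w) * int m)
    (\<lambda>j. \<kappa> (H_elem (of_int (- alt_sum (Gamma1 p q) w r) * \<alpha>
      + of_int (alt_sum (Gamma2 p q) w s * int m + offset (opp (V_node w)) j))))"
proof -
  consider "w = 1" | "w \<noteq> 1" "even w" | "w \<noteq> 1" "odd w" by blast
  then show ?thesis
  proof cases
    case 1
    then show ?thesis
      using alt_sum_Suc[of "Gamma2 p q" 1 s]
      by (simp add: H_prod_tilde_def Let_def V_node_def Gamma_initial[unfolded One_nat_def] numeral_2_eq_2[symmetric] algebra_simps)
  next
    case 2
    then obtain l where w: "w = 2 * l" "l \<ge> 1" using assms by (elim evenE) auto
    then show ?thesis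
      using 2 by (simp add: H_prod_tilde_def Let_def V_node_def algebra_simps)
  next
    case 3
    then obtain l where w: "w = 2 * l + 1" "l \<ge> 1" using assms by (elim oddE) auto
    show ?thesis
      using 3 w by (simp add: H_prod_tilde_def Let_def V_node_def algebra_simps)
  qed
qed

lemma V_shift:
  assumes "1 \<le> w" "w \<le> k"
  shows "of_int (- alt_sum (Gamma2 p q) (w + 1) (int k)) * \<alpha>
      + of_int (alt_sum (Gamma1 p q) (w - 1) (int k - 2) * int m)
    = (\<Sum>i=w..<k. sg (V_node i) * V_exp p q m \<alpha> i)"
proof -
  obtain w' k' where wk: "w = Suc w'" "k = Suc k'"
    using assms by (metis One_nat_def Suc_le_D le_trans)
  have "- alt_sum (Gamma2 p q) (w + 1) (int k) = (\<Sum>i=w..<k. (-1) ^ i * Gamma2 p q (i + 1))"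
    using alt_sum_ivl[of "Gamma2 p q" "Suc w" "Suc k"]
    by (simp only: sum.shift_bounds_Suc_ivl) (simp add: sum_negf)
  moreover have "alt_sum (Gamma1 p q) (w - 1) (int k - 2)
      = (\<Sum>i=w..<k. - ((-1) ^ i * Gamma1 p q (i - 1)))"
    using alt_sum_ivl[of "Gamma1 p q" w' k'] unfolding wk sum.shift_bounds_Suc_ivl by simp
  ultimately show ?thesis
    by (simp add: sg_V_node V_exp_def sum_distrib_left algebra_simps sum_subtractf sum_negf)
qed

lemma V_tilde_shift:
  assumes "1 \<le> w" "w \<le> k"
  shows "of_int (- alt_sum (Gamma1 p q) w (int k - 1)) * \<alpha>
      + of_int (alt_sum (Gamma2 p q) w (int k - 1) * int m)
    = (\<Sum>i=w..<k. sg (opp (V_node i)) * V_tilde_exp p q m \<alpha> i)"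
  unfolding alt_sum_ivl
  by (simp add: sg_V_node V_tilde_exp_def sum_distrib_left algebra_simps sum_subtractf)

lemma projection_hom:
  assumes "is_projection p q \<pi>" "skew_field_of_fractions U_H K \<kappa>"
  shows "\<kappa> \<circ> \<pi> \<in> ring_hom (U_N p q) K"
    and "\<kappa> (\<pi> (U_N_f p q i)) = \<kappa> (U_H_f i)"
    and "\<kappa> (\<pi> (env_const (n_minus (cartan p q)) c)) = \<kappa> (env_const heisenberg c)"
  using assms(1) skew_field_heisenberg_ring(2)[OF assms(2)]
  by (auto simp: is_projection_def env_algebra_hom_def intro: ring_hom_trans)

lemma projected_word_product:
  fixes Q :: "node \<Rightarrow> 'b ring" and K :: "'k ring"
  assumes ore: "\<And>i. ore_localization (U_N p q) (powers (U_N p q) (U_N_f p q i)) (Q i) (\<iota> i)"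
    and K: "skew_field_of_fractions U_H K \<kappa>"
    and \<pi>: "is_projection p q \<pi>"
    and nd: "\<And>k. nd (Suc k) = opp (nd k)"
    and base: "V 1 = U_N_f p q (nd 0) [^]\<^bsub>U_N p q\<^esub> m" and e1: "e 1 = int m"
    and step: "\<And>k. k \<ge> 1 \<Longrightarrow> \<exists>b. is_f_power_conj p q Q \<iota> (nd k) (a k) (V k) b (V (Suc k))
      \<and> a k + b = of_int (s k)"
    and e: "\<And>k. k \<ge> 1 \<Longrightarrow> e (Suc k) = s k - e k"
    and k: "k \<ge> (1::nat)"
  shows "\<kappa> (\<pi> (V k)) = list_prod K (map (\<lambda>w. upto_prod K (e w)
      (\<lambda>j. \<kappa> (H_elem (of_int (offset (nd w) j) + (\<Sum>i=w..<k. sg (nd i) * a i))))) [1..<k])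
    \<otimes>\<^bsub>K\<^esub> \<kappa> (U_H_f (nd (k - 1))) [^]\<^bsub>K\<^esub> e k"
proof -
  let ?L = "n_minus (cartan p q)"
  interpret N: lie_closed ?L by (rule n_minus_lie_closed)
  interpret HR: heisenberg_ring K "\<lambda>c. \<kappa> (env_const heisenberg c)" "\<lambda>i. \<kappa> (U_H_f i)" "\<kappa> U_H_h"
    by (rule skew_field_heisenberg_ring(1)[OF K])
  note hom = projection_hom(1)[OF \<pi> K]
  interpret \<theta>: ring_hom_ring "U_N p q" K "\<kappa> \<circ> \<pi>"
    using hom by unfold_locales
  have H: "\<kappa> (H_elem u) = HR.H u" for u
    unfolding HR.H_def by (rule skew_field_heisenberg_ring(3)[OF K])
  have f: "U_N_f p q i \<in> carrier (U_N p q)" for i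
    unfolding U_N_f_def by (rule N.env_gen_closed[OF km_f_in_n_minus])
  have V: "V k \<in> carrier (U_N p q)" if "k \<ge> 1" for k
    using that
  proof (induction k rule: nat_induct_at_least)
    case base
    then show ?case using f by (simp add: \<open>V 1 = _\<close>[unfolded One_nat_def])
  next
    case (Suc k)
    then show ?case using step[OF Suc.hyps] unfolding is_power_conj_def by blast
  qed
  have "\<kappa> (\<pi> (V k)) = list_prod K (map (\<lambda>w. upto_prod K (e w)
      (\<lambda>j. HR.H (of_int (offset (nd w) j) + (\<Sum>i=w..<k. sg (nd i) * a i)))) [1..<k])
    \<otimes>\<^bsub>K\<^esub> \<kappa> (U_H_f (nd (k - 1))) [^]\<^bsub>K\<^esub> e k"
  proof (rule HR.word_product[where X = "\<lambda>k. \<kappa> (\<pi> (V k))" and s = s])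
    show "nd (Suc k) = opp (nd k)" for k by (rule nd)
    show "\<kappa> (\<pi> (V 1)) = \<kappa> (U_H_f (nd 0)) [^]\<^bsub>K\<^esub> e 1"
      using \<theta>.hom_nat_pow[OF f] unfolding base e1 int_pow_int
      by (simp add: projection_hom(2)[OF \<pi> K])
    show "e (Suc k) = s k - e k" if "k \<ge> 1" for k by (rule e[OF that])
  next
    fix k P and N :: int assume k: "k \<ge> 1" and P: "HR.shift_family P"
      and X: "\<kappa> (\<pi> (V k)) = P 0 \<otimes>\<^bsub>K\<^esub> \<kappa> (U_H_f (nd k)) [^]\<^bsub>K\<^esub> N"
    let ?f = "U_N_f p q (nd k)"
    obtain b where b: "is_f_power_conj p q Q \<iota> (nd k) (a k) (V k) b (V (Suc k))"
      "a k + b = of_int (s k)"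
      using step[OF k] by blast
    obtain M where M: "(ad (U_N p q) ?f ^^ M) (V k) = \<zero>\<^bsub>U_N p q\<^esub>"
      using ad_f_locally_nilpotent[OF V[OF k], of "nd k"] unfolding U_N_f_def by blast
    have "(\<kappa> \<circ> \<pi>) ?f \<in> Units K"
      using HR.F_Units by (simp add: projection_hom(2)[OF \<pi> K])
    note * = power_conj_image[OF n_minus_lie_closed ore b f V[OF k] M HR.ring_axioms hom this]
    have "(ad K (\<kappa> (U_H_f (nd k))) ^^ M) (\<kappa> (\<pi> (V k))) = \<zero>\<^bsub>K\<^esub>"
      using \<theta>.hom_ad[OF f[of "nd k"] V[OF k], of M]
      by (simp add: M projection_hom(2)[OF \<pi> K] \<theta>.hom_zero[unfolded comp_apply])
    then show "\<kappa> (\<pi> (V (Suc k))) = P (sg (nd k) * a k) \<otimes>\<^bsub>K\<^esub> \<kappa> (U_H_f (nd k)) [^]\<^bsub>K\<^esub> (N + s k)"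
      using * HR.complex_conj_shift_family[OF P X, of M "a k" "s k"]
      by (simp add: projection_hom(2,3)[OF \<pi> K])
  qed (rule k)
  then show ?thesis unfolding H .
qed

theorem theorem3:
  fixes p q m n :: nat and \<alpha> :: complex
    and Q :: "node \<Rightarrow> 'b ring" and \<iota> :: "node \<Rightarrow> n_minus_env \<Rightarrow> 'b"
    and K :: "'k ring" and \<kappa> :: "heis_env \<Rightarrow> 'k"
    and \<pi> :: "n_minus_env \<Rightarrow> heis_env"
    and V V_tilde :: "nat \<Rightarrow> n_minus_env"
  assumes "p \<ge> 1" and "q \<ge> 1" and "p * q \<ge> 4" and "m \<ge> 1" and "n \<ge> 1"
    and "\<And>i. ore_localization (U_N p q) (powers (U_N p q) (U_N_f p q i)) (Q i) (\<iota> i)"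
    and "skew_field_of_fractions U_H K \<kappa>"
    and "is_projection p q \<pi>"
    and "is_V p q Q \<iota> m \<alpha> V"
    and "is_V_tilde p q Q \<iota> m \<alpha> V_tilde"
  shows "\<kappa> (\<pi> (V (2*n - 1))) =
           list_prod K (map (H_prod p q m \<alpha> K \<kappa> (2 * int n - 1) (2 * int n - 3)) [1..<2*n - 1])
           \<otimes>\<^bsub>K\<^esub> \<kappa> (U_H_f N1) [^]\<^bsub>K\<^esub> ((Gamma1 p q (2*n - 1) - Gamma1 p q (2*n - 2)) * int m)
       \<and> \<kappa> (\<pi> (V (2*n))) =
           list_prod K (map (H_prod p q m \<alpha> K \<kappa> (2 * int n) (2 * int n - 2)) [1..<2*n])
           \<otimes>\<^bsub>K\<^esub> \<kappa> (U_H_f N2) [^]\<^bsub>K\<^esub> ((Gamma1 p q (2*n) - Gamma1 p q (2*n - 1)) * int m)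
       \<and> \<kappa> (\<pi> (V_tilde (2*n - 1))) =
           list_prod K (map (H_prod_tilde p q m \<alpha> K \<kappa> (2 * int n - 2) (2 * int n - 2)) [1..<2*n - 1])
           \<otimes>\<^bsub>K\<^esub> \<kappa> (U_H_f N2) [^]\<^bsub>K\<^esub> ((Gamma2 p q (2*n) - Gamma2 p q (2*n - 1)) * int m)
       \<and> \<kappa> (\<pi> (V_tilde (2*n))) =
           list_prod K (map (H_prod_tilde p q m \<alpha> K \<kappa> (2 * int n - 1) (2 * int n - 1)) [1..<2*n])
           \<otimes>\<^bsub>K\<^esub> \<kappa> (U_H_f N1) [^]\<^bsub>K\<^esub> ((Gamma2 p q (2*n + 1) - Gamma2 p q (2*n)) * int m)"
proof -
  note ore = assms(6) and K = assms(7) and \<pi> = assms(8)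
  have V: "\<kappa> (\<pi> (V k)) = list_prod K (map (H_prod p q m \<alpha> K \<kappa> (int k) (int k - 2)) [1..<k])
      \<otimes>\<^bsub>K\<^esub> \<kappa> (U_H_f (V_node (k - 1))) [^]\<^bsub>K\<^esub> ((Gamma1 p q k - Gamma1 p q (k - 1)) * int m)"
    if "k \<ge> 1" for k
  proof -
    have "map (H_prod p q m \<alpha> K \<kappa> (int k) (int k - 2)) [1..<k]
      = map (\<lambda>w. upto_prod K ((Gamma1 p q w - Gamma1 p q (w - 1)) * int m)
          (\<lambda>j. \<kappa> (H_elem (of_int (offset (V_node w) j) + (\<Sum>i=w..<k. sg (V_node i) * V_exp p q m \<alpha> i))))) [1..<k]"
    proof (rule map_cong[OF HOL.refl])
      fix w assume "w \<in> set [1..<k]"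
      then have "1 \<le> w" "w \<le> k" by simp_all
      then show "H_prod p q m \<alpha> K \<kappa> (int k) (int k - 2) w
        = upto_prod K ((Gamma1 p q w - Gamma1 p q (w - 1)) * int m)
            (\<lambda>j. \<kappa> (H_elem (of_int (offset (V_node w) j) + (\<Sum>i=w..<k. sg (V_node i) * V_exp p q m \<alpha> i))))"
        unfolding H_prod_uniform[OF \<open>1 \<le> w\<close>] V_shift[OF \<open>1 \<le> w\<close> \<open>w \<le> k\<close>, symmetric]
        by (simp add: ac_simps)
    qed
    moreover have "\<kappa> (\<pi> (V k)) = list_prod K (map (\<lambda>w. upto_prod K ((Gamma1 p q w - Gamma1 p q (w - 1)) * int m)
          (\<lambda>j. \<kappa> (H_elem (of_int (offset (V_node w) j) + (\<Sum>i=w..<k. sg (V_node i) * V_exp p q m \<alpha> i))))) [1..<k])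
      \<otimes>\<^bsub>K\<^esub> \<kappa> (U_H_f (V_node (k - 1))) [^]\<^bsub>K\<^esub> ((Gamma1 p q k - Gamma1 p q (k - 1)) * int m)"
    proof (rule projected_word_product[where m = m and nd = V_node and V = V
          and e = "\<lambda>k. (Gamma1 p q k - Gamma1 p q (k - 1)) * int m" and a = "V_exp p q m \<alpha>"
          and s = "\<lambda>k. (Gamma1 p q (k + 1) - Gamma1 p q (k - 1)) * int m", OF ore K \<pi> V_node_Suc])
      show "V 1 = U_N_f p q (V_node 0) [^]\<^bsub>U_N p q\<^esub> m"
        using assms(9) by (simp add: is_V_def V_node_def Let_def)
    qed (use that is_V_step[OF assms(9)] in
        \<open>simp_all add: Gamma_initial[unfolded One_nat_def] algebra_simps\<close>)
    ultimately show ?thesis by (simp only:)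
  qed
  have V_tilde: "\<kappa> (\<pi> (V_tilde k)) = list_prod K (map (H_prod_tilde p q m \<alpha> K \<kappa> (int k - 1) (int k - 1)) [1..<k])
      \<otimes>\<^bsub>K\<^esub> \<kappa> (U_H_f (opp (V_node (k - 1)))) [^]\<^bsub>K\<^esub> ((Gamma2 p q (k + 1) - Gamma2 p q k) * int m)"
    if "k \<ge> 1" for k
  proof -
    have "map (H_prod_tilde p q m \<alpha> K \<kappa> (int k - 1) (int k - 1)) [1..<k]
      = map (\<lambda>w. upto_prod K ((Gamma2 p q (w + 1) - Gamma2 p q w) * int m)
          (\<lambda>j. \<kappa> (H_elem (of_int (offset (opp (V_node w)) j)
            + (\<Sum>i=w..<k. sg (opp (V_node i)) * V_tilde_exp p q m \<alpha> i))))) [1..<k]"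
    proof (rule map_cong[OF HOL.refl])
      fix w assume "w \<in> set [1..<k]"
      then have "1 \<le> w" "w \<le> k" by simp_all
      then show "H_prod_tilde p q m \<alpha> K \<kappa> (int k - 1) (int k - 1) w
        = upto_prod K ((Gamma2 p q (w + 1) - Gamma2 p q w) * int m)
            (\<lambda>j. \<kappa> (H_elem (of_int (offset (opp (V_node w)) j)
              + (\<Sum>i=w..<k. sg (opp (V_node i)) * V_tilde_exp p q m \<alpha> i))))"
        unfolding H_prod_tilde_uniform[OF \<open>1 \<le> w\<close>] V_tilde_shift[OF \<open>1 \<le> w\<close> \<open>w \<le> k\<close>, symmetric]
        by (simp add: ac_simps)
    qed
    moreover have "\<kappa> (\<pi> (V_tilde k)) = list_prod K (map (\<lambda>w. upto_prod K ((Gamma2 p q (w + 1) - Gamma2 p q w) * int m)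
          (\<lambda>j. \<kappa> (H_elem (of_int (offset (opp (V_node w)) j)
            + (\<Sum>i=w..<k. sg (opp (V_node i)) * V_tilde_exp p q m \<alpha> i))))) [1..<k])
      \<otimes>\<^bsub>K\<^esub> \<kappa> (U_H_f (opp (V_node (k - 1)))) [^]\<^bsub>K\<^esub> ((Gamma2 p q (k + 1) - Gamma2 p q k) * int m)"
    proof (rule projected_word_product[where m = m and nd = "\<lambda>k. opp (V_node k)" and V = V_tilde
          and e = "\<lambda>k. (Gamma2 p q (k + 1) - Gamma2 p q k) * int m" and a = "V_tilde_exp p q m \<alpha>"
          and s = "\<lambda>k. (Gamma2 p q (k + 2) - Gamma2 p q k) * int m", OF ore K \<pi>])
      show "opp (V_node (Suc k)) = opp (opp (V_node k))" for k
        by (simp add: V_node_Suc)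
      show "V_tilde 1 = U_N_f p q (opp (V_node 0)) [^]\<^bsub>U_N p q\<^esub> m"
        using assms(10) by (simp add: is_V_tilde_def V_node_def Let_def)
    qed (use that is_V_tilde_step[OF assms(10)] in
        \<open>simp_all add: Gamma_initial[unfolded One_nat_def] numeral_2_eq_2[symmetric] algebra_simps\<close>)
    ultimately show ?thesis by (simp only:)
  qed
  have n: "int (2 * n - 1) = 2 * int n - 1" "2 * n - Suc (Suc 0) = 2 * n - 2" "even (2 * n - 2)"
      "odd (2 * n - 1)" "2 * n - 1 + 1 = 2 * n"
    using \<open>n \<ge> 1\<close> by auto
  show ?thesis
    using V[of "2 * n - 1"] V[of "2 * n"] V_tilde[of "2 * n - 1"] V_tilde[of "2 * n"] \<open>n \<ge> 1\<close>
    by (simp add: n V_node_def)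
qed

end
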